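(* Let $A\in\mathbb{R}^{N\times N}$ be symmetric positive semidefinite of rank $K$. Suppose that $\mathcal{P}_c$ is a partition of $[N]$, that $\mathcal{P}_f$ is a refinement of $\mathcal{P}_c$, and that $\mathcal{P}_f$ is regular-sparse with respect to $A$. Let $\{g_k^{(c)}\}_{k=1}^K$ and $\{g_k^{(f)}\}_{k=1}^K$ be the modes produced by the ISMD procedure applied to $A$ with $\mathcal{P}_c$ and $\mathcal{P}_f$, respectively. Then, after reordering the modes if necessary, for every $k\in\{1,\dots,K\}$, $$\{P\in\mathcal{P}_c: g_k^{(f)}|_P\neq 0\}=\{P\in\mathcal{P}_c: g_k^{(c)}|_P\ne 0\},$$ $$\{P\in\mathcal{P}_f: g_k^{(f)}|_P\neq 0\}\subset\{P\in\mathcal{P}_f: g_k^{(c)}|_P\ne 0\}.$$ Moreover, if $g_k^{(c)}$ is identifiable on $\mathcal{P}_c$ (i.e. identifiable from every other $g_j^{(c)}$, $j\ne k$), then $g_k^{(f)}=\pm g_k^{(c)}$.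
   Context: **Basic notions.** $[N]=\{1,\dots,N\}$. $A\in\mathbb{R}^{N\times N}$ is symmetric positive semidefinite of rank $K$. Partitions of $[N]$ are into disjoint nonempty patches; $\mathcal{P}_f$ is a refinement of $\mathcal{P}_c$ if every patch of $\mathcal{P}_f$ is contained in a patch of $\mathcal{P}_c$. For $\psi\in\mathbb{R}^N$, $\psi|_P\in\mathbb{R}^{|P|}$ is its restriction to $P$. A partition $\mathcal{P}=\{P_m\}_{m=1}^M$ is *regular-sparse with respect to $A$* if there is a decomposition $A=\sum_{k=1}^K g_kg_k^T$ (with $K$ the rank of $A$) such that for every patch $P_m$ the vectors among $g_1|_{P_m},\dots,g_K|_{P_m}$ belonging to modes that are nonzero on $P_m$ are linearly independent. Two modes $g,g'\in\mathbb{R}^N$ are *unidentifiable* on $\mathcal{P}$ if $\{P\in\mathcal{P}:g|_P\neq0\}=\{P\in\mathcal{P}:g'|_P\neq0\}$, and *identifiable* otherwise. **ISMD (intrinsic sparse mode decomposition) procedure for $(A,\mathcal{P})$, $\mathcal{P}=\{P_m\}_{m=1}^M$.** Order indices so that $A$ has blocks $A_{mn}$ (rows in $P_m$, columns in $P_n$). 1. For each $m$, let $K_m=\operatorname{rank}A_{mm}$, take an eigendecomposition $A_{mm}=\sum_{i=1}^{K_m}\gamma_{m,i}h_{m,i}h_{m,i}^T$ with $\gamma_{m,i}>0$ and $h_{m,i}$ orthonormal, and put $H_m=[\gamma_{m,1}^{1/2}h_{m,1},\dots,\gamma_{m,K_m}^{1/2}h_{m,K_m}]$, so $A_{mm}=H_mH_m^T$.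 With $H_m^\dagger=(H_m^TH_m)^{-1}H_m^T$, let $\Lambda$ be the block matrix with blocks $\Lambda_{mn}=H_m^\dagger A_{mn}(H_n^\dagger)^T\in\mathbb{R}^{K_m\times K_n}$. With $H_{ext}=\operatorname{diag}\{H_1,\dots,H_M\}$ one has $A=H_{ext}\Lambda H_{ext}^T$. 2. For each $m$, let $\Sigma_{n;m}=\Lambda_{mn}\Lambda_{mn}^T$ and let $D_m$ be any (global) minimizer of $\sum_{n=1}^M\sum_{i\ne j}|(V^T\Sigma_{n;m}V)_{i,j}|^2$ over orthogonal matrices $V\in\mathbb{R}^{K_m\times K_m}$. Let $D=\operatorname{diag}\{D_1,\dots,D_M\}$, $\Omega=D^T\Lambda D$. 3. Take a pivoted Cholesky decomposition $\Omega=PLL^TP^T$, where $P$ is a permutation matrix and $L$ is a lower triangular (trapezoidal) matrix of size $(\sum_mK_m)\times K$ with positive diagonal entries. Output the columns $g_1,\dots,g_K$ of $G=H_{ext}DPL$, so that $A=GG^T$. *)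

theory Defs
  imports
    "Jordan_Normal_Form.DL_Submatrix"
    "Jordan_Normal_Form.DL_Rank"
    "Jordan_Normal_Form.Gauss_Jordan_Elimination"
    "HOL-Library.Disjoint_Sets"
begin

text \<open>
  Conventions: the index set $[N]$ is \<^term>\<open>{..<N}\<close>, modes are vectors in
  \<^term>\<open>carrier_vec N\<close>, and a partition is a set of sets of indices
  (\<^const>\<open>partition_on\<close>, \<^const>\<open>refines\<close>). The entries of a patch are listed in increasing
  order by \<^const>\<open>pick\<close>, which is also what \<^const>\<open>submatrix\<close> uses.
\<close>

abbreviation mat_rank :: "real mat \<Rightarrow> nat" where
  "mat_rank A \<equiv> vec_space.rank (dim_row A) A"

definition sym_psd :: "real mat \<Rightarrow> bool" where
  "sym_psd A \<longleftrightarrow> A\<^sup>T = A \<and> (\<forall>v \<in> carrier_vec (dim_row A). 0 \<le> v \<bullet> (A *\<^sub>v v))"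

definition vec_restrict :: "real vec \<Rightarrow> nat set \<Rightarrow> real vec" where
  "vec_restrict v P = vec (card P) (\<lambda>i. v $ pick P i)"

definition nonzero_on :: "real vec \<Rightarrow> nat set \<Rightarrow> bool" where
  "nonzero_on v P \<longleftrightarrow> vec_restrict v P \<noteq> 0\<^sub>v (card P)"

definition patch_support :: "nat set set \<Rightarrow> real vec \<Rightarrow> nat set set" where
  "patch_support \<P> g = {P \<in> \<P>. nonzero_on g P}"

definition unidentifiable :: "nat set set \<Rightarrow> real vec \<Rightarrow> real vec \<Rightarrow> bool" where
  "unidentifiable \<P> g g' \<longleftrightarrow> patch_support \<P> g = patch_support \<P> g'"

text \<open>The matrix \<open>\<Sum>k<K. c k \<cdot> g k (g k)\<^sup>T\<close>.\<close>

definition sum_outer :: "nat \<Rightarrow> nat \<Rightarrow> (nat \<Rightarrow> real) \<Rightarrow> (nat \<Rightarrow> real vec) \<Rightarrow> real mat" where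
  "sum_outer n K c g = mat n n (\<lambda>(a, b). \<Sum>k<K. c k * (g k $ a * g k $ b))"

text \<open>Linear independence of an indexed family: \<^const>\<open>module.lin_dep\<close> concerns sets and so does
  not see repeated vectors, hence the injectivity.\<close>

definition lin_indpt_family :: "nat \<Rightarrow> nat set \<Rightarrow> (nat \<Rightarrow> real vec) \<Rightarrow> bool" where
  "lin_indpt_family n S f \<longleftrightarrow>
     inj_on f S \<and> module.lin_indpt class_ring (module_vec TYPE(real) n) (f ` S)"

definition regular_sparse :: "real mat \<Rightarrow> nat set set \<Rightarrow> bool" where
  "regular_sparse A \<P> \<longleftrightarrow>
     (\<exists>g. (\<forall>k < mat_rank A. g k \<in> carrier_vec (dim_row A)) \<and>
          A = sum_outer (dim_row A) (mat_rank A) (\<lambda>_. 1) g \<and>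
          (\<forall>P \<in> \<P>. lin_indpt_family (card P) {k. k < mat_rank A \<and> nonzero_on (g k) P}
                       (\<lambda>k. vec_restrict (g k) P)))"

text \<open>\<^const>\<open>orthogonal_mat\<close> only asks the columns to be nonzero and pairwise orthogonal.\<close>

definition real_orthogonal :: "nat \<Rightarrow> real mat \<Rightarrow> bool" where
  "real_orthogonal n V \<longleftrightarrow> V \<in> carrier_mat n n \<and> V\<^sup>T * V = 1\<^sub>m n"

definition eigendecomposition :: "real mat \<Rightarrow> (nat \<Rightarrow> real) \<Rightarrow> (nat \<Rightarrow> real vec) \<Rightarrow> bool" where
  "eigendecomposition B \<gamma> h \<longleftrightarrow>
     (\<forall>i < mat_rank B. 0 < \<gamma> i \<and> h i \<in> carrier_vec (dim_row B)) \<and>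
     (\<forall>i < mat_rank B. \<forall>j < mat_rank B. h i \<bullet> h j = (if i = j then 1 else 0)) \<and>
     B = sum_outer (dim_row B) (mat_rank B) \<gamma> h"

text \<open>The Moore-Penrose inverse of a matrix of full column rank; only then does \<^const>\<open>mat_inverse\<close>
  return a value here.\<close>

definition left_pinv :: "real mat \<Rightarrow> real mat" where
  "left_pinv H = the (mat_inverse (H\<^sup>T * H)) * H\<^sup>T"

definition off_diag_sq :: "nat \<Rightarrow> real mat \<Rightarrow> real" where
  "off_diag_sq k B = (\<Sum>i<k. \<Sum>j \<in> {..<k} - {i}. \<bar>B $$ (i, j)\<bar>\<^sup>2)"

definition pivoted_cholesky :: "real mat \<Rightarrow> nat \<Rightarrow> real mat \<Rightarrow> real mat \<Rightarrow> bool" where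
  "pivoted_cholesky \<Omega> K Q L \<longleftrightarrow>
     (let s = dim_row \<Omega> in
       (\<exists>\<pi>. \<pi> permutes {..<s} \<and> Q = mat s s (\<lambda>(i, j). if i = \<pi> j then 1 else 0)) \<and>
       K \<le> s \<and> L \<in> carrier_mat s K \<and>
       (\<forall>i<s. \<forall>j<K. i < j \<longrightarrow> L $$ (i, j) = 0) \<and>
       (\<forall>j<K. 0 < L $$ (j, j)) \<and>
       \<Omega> = Q * L * L\<^sup>T * Q\<^sup>T)"

text \<open>The positions of block \<open>m\<close> when consecutive blocks have sizes \<open>s 0, s 1, \<dots>\<close>.\<close>

definition block_range :: "(nat \<Rightarrow> nat) \<Rightarrow> nat \<Rightarrow> nat set" where
  "block_range s m = {(\<Sum>l<m. s l)..<(\<Sum>l<Suc m. s l)}"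

text \<open>
  \<open>ismd A Ps g\<close>: the vectors \<open>g 0, \<dots>, g (K - 1)\<close> with \<open>K = mat_rank A\<close> are a possible output for
  the patches enumerated as \<open>Ps\<close>; every choice left open by the procedure is existentially
  quantified. \<open>\<Lambda>\<close> is determined by its blocks. The rows of the product
  \<open>H\<^sub>e\<^sub>x\<^sub>t D Q L\<close> are in the order that lists the patches one after the other, and the last conjunct
  brings its columns back to the original order of the indices.
\<close>

definition ismd :: "real mat \<Rightarrow> nat set list \<Rightarrow> (nat \<Rightarrow> real vec) \<Rightarrow> bool" where
  "ismd A Ps g \<longleftrightarrow>
     (\<exists>\<gamma> h \<Lambda> D Q L.
       let K = mat_rank A;
           M = length Ps;
           Ab = (\<lambda>m n. submatrix A (Ps ! m) (Ps ! n));
           Km = (\<lambda>m. mat_rank (Ab m m));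
           H = (\<lambda>m. mat_of_cols (card (Ps ! m)) (map (\<lambda>i. sqrt (\<gamma> m i) \<cdot>\<^sub>v h m i) [0..<Km m]));
           \<Lambda>b = (\<lambda>m n. left_pinv (H m) * Ab m n * (left_pinv (H n))\<^sup>T);
           \<Sigma> = (\<lambda>n m. \<Lambda>b m n * (\<Lambda>b m n)\<^sup>T);
           s = (\<Sum>m<M. Km m);
           Hext = diag_block_mat (map H [0..<M]);
           Dext = diag_block_mat (map D [0..<M]);
           G = Hext * Dext * Q * L
       in
         (\<forall>m<M. eigendecomposition (Ab m m) (\<gamma> m) (h m)) \<and>
         \<Lambda> \<in> carrier_mat s s \<and>
         (\<forall>m<M. \<forall>n<M. submatrix \<Lambda> (block_range Km m) (block_range Km n) = \<Lambda>b m n) \<and>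
         (\<forall>m<M. is_arg_min (\<lambda>V. \<Sum>n<M. off_diag_sq (Km m) (V\<^sup>T * \<Sigma> n m * V))
                  (real_orthogonal (Km m)) (D m)) \<and>
         pivoted_cholesky (Dext\<^sup>T * \<Lambda> * Dext) K Q L \<and>
         (\<forall>k<K. g k \<in> carrier_vec (dim_row A) \<and>
            (\<forall>m<M. vec_restrict (g k) (Ps ! m) =
                    vec_restrict (col G k) (block_range (\<lambda>l. card (Ps ! l)) m))))"

definition ismd_modes :: "real mat \<Rightarrow> nat set set \<Rightarrow> (nat \<Rightarrow> real vec) \<Rightarrow> bool" where
  "ismd_modes A \<P> g \<longleftrightarrow> (\<exists>Ps. distinct Ps \<and> set Ps = \<P> \<and> ismd A Ps g)"

end

theory Submission
  imports Defs
begin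

text \<open>
  Let \<open>g\<close> be the modes of the regular-sparse decomposition; it is regular-sparse on every coarser
  partition too. On each patch \<open>G\<^sub>m = H\<^sub>m U\<^sub>m\<close>, where the rows of \<open>U\<^sub>m\<close> are orthonormal and its nonzero
  columns are orthonormal as well, so \<open>\<Lambda>\<^sub>m\<^sub>n = U\<^sub>m U\<^sub>n\<^sup>T\<close> and all \<open>\<Sigma>\<^sub>n\<^sub>;\<^sub>m\<close> are diagonalized simultaneously by
  the nonzero part of \<open>U\<^sub>m\<close>. Hence the minimum in step 2 is \<open>0\<close>, and each row of \<open>E = D\<^sup>T U\<close> involves
  only modes with one and the same patch support. The Cholesky columns inherit this, and comparing
  the two factorizations \<open>E E\<^sup>T = (Q L) (Q L)\<^sup>T\<close> shows that the output modes are \<open>g W\<close> with \<open>W\<close> orthogonal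
  and mixing only modes of equal patch support.

  For the two partitions this gives \<open>g\<^sub>c = g\<^sub>f V\<close> with \<open>V = W\<^sub>f\<^sup>T W\<^sub>c\<close> orthogonal. As \<open>det V \<noteq> 0\<close>, some term of
  the Leibniz expansion is nonzero, which is the required reordering.
\<close>

subsection \<open>Factors with equal Gram matrices\<close>

text \<open>The diagonal entries of \<open>X * X\<^sup>T\<close> are the squared norms of the rows
  of \<open>X\<close>.\<close>

lemma gram_eq_zeroD:
  fixes X :: "real mat"
  assumes X: "X \<in> carrier_mat n m" and 0: "X * X\<^sup>T = 0\<^sub>m n n"
  shows "X = 0\<^sub>m n m"
proof (rule eq_matI)
  fix i j assume "i < dim_row (0\<^sub>m n m :: real mat)" "j < dim_col (0\<^sub>m n m :: real mat)"
  then have ij: "i < n" "j < m" by auto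
  have "(X * X\<^sup>T) $$ (i,i) = (\<Sum>k<m. X $$ (i,k) * X $$ (i,k))"
    using X ij by (simp add: scalar_prod_def lessThan_atLeast0)
  then have "(\<Sum>k<m. X $$ (i,k) * X $$ (i,k)) = 0" using 0 ij by simp
  then have "X $$ (i,j) * X $$ (i,j) = 0"
    using ij sum_nonneg_eq_0_iff[of "{..<m}" "\<lambda>k. X $$ (i,k) * X $$ (i,k)"] by auto
  then show "X $$ (i, j) = 0\<^sub>m n m $$ (i, j)" using ij by simp
qed (use X in auto)

text \<open>Multiplying the equality of Gram matrices by \<open>X\<close> on the left and
  \<open>X\<^sup>T\<close> on the right turns \<open>H\<close> into the identity. For the second
  claim, \<open>1 - H * X\<close> kills \<open>H\<close>, hence it kills the Gram matrix of
  \<open>G\<close> and so \<open>G\<close> itself. Two factors of one matrix thus differ by a matrix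
  with orthonormal rows.\<close>

lemma gram_eq_left_inverse:
  fixes G H X :: "real mat"
  assumes G: "G \<in> carrier_mat n K" and H: "H \<in> carrier_mat n r" and X: "X \<in> carrier_mat r n"
    and XH: "X * H = 1\<^sub>m r" and eq: "G * G\<^sup>T = H * H\<^sup>T"
  shows "(X * G) * (X * G)\<^sup>T = 1\<^sub>m r" "H * (X * G) = G"
proof -
  have HtXt: "H\<^sup>T * X\<^sup>T = 1\<^sub>m r"
    using XH transpose_mult[OF X H] by (metis transpose_one)
  have "(X * G) * (X * G)\<^sup>T = X * (G * G\<^sup>T) * X\<^sup>T"
    using G X by (simp add: transpose_mult[OF X G] assoc_mult_mat[of _ r n _ n _ r]
        assoc_mult_mat[of _ r n _ K _ r] assoc_mult_mat[of _ n K _ n _ r])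
  also have "\<dots> = (X * H) * (H\<^sup>T * X\<^sup>T)"
    unfolding eq using H X by (simp add: assoc_mult_mat[of _ r n _ n _ r]
        assoc_mult_mat[of _ r n _ r _ r] assoc_mult_mat[of _ n r _ n _ r])
  finally show "(X * G) * (X * G)\<^sup>T = 1\<^sub>m r" by (simp add: XH HtXt)
  define P where "P = 1\<^sub>m n - H * X"
  have P: "P \<in> carrier_mat n n" unfolding P_def using H X by auto
  have PH: "P * H = 0\<^sub>m n r"
  proof -
    have "P * H = 1\<^sub>m n * H - H * X * H" unfolding P_def using H X
      by (intro minus_mult_distrib_mat[of _ n n]) auto
    also have "H * X * H = H" using H X XH by (simp add: assoc_mult_mat[of _ n r _ n _ r])
    finally show ?thesis using H by auto
  qed
  have "(P * G) * (P * G)\<^sup>T = P * (G * G\<^sup>T) * P\<^sup>T"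
    using G P by (simp add: transpose_mult[OF P G] assoc_mult_mat[of _ n n _ n _ n]
        assoc_mult_mat[of _ n n _ K _ n] assoc_mult_mat[of _ n K _ n _ n])
  also have "\<dots> = (P * H) * (H\<^sup>T * P\<^sup>T)"
    unfolding eq using H P by (simp add: assoc_mult_mat[of _ n n _ n _ n]
        assoc_mult_mat[of _ n n _ r _ n] assoc_mult_mat[of _ n r _ n _ n])
  also have "\<dots> = 0\<^sub>m n n" unfolding PH using H P by simp
  finally have "P * G = 0\<^sub>m n K" using gram_eq_zeroD[of "P * G" n K] P G by simp
  moreover have "P * G = G - H * (X * G)" unfolding P_def using G H X
    by (subst minus_mult_distrib_mat[of _ n n]) (auto simp: assoc_mult_mat[of _ n r _ n _ K])
  ultimately have z: "G - H * (X * G) = 0\<^sub>m n K" by simp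
  show "H * (X * G) = G"
  proof (rule eq_matI)
    fix i j assume ij: "i < dim_row G" "j < dim_col G"
    then have "(G - H * (X * G)) $$ (i,j) = G $$ (i,j) - (H * (X * G)) $$ (i,j)"
      using G H X by (intro index_minus_mat) auto
    then show "(H * (X * G)) $$ (i, j) = G $$ (i, j)" unfolding z using ij G by simp
  qed (use G H X in auto)
qed

lemma mult_entry:
  assumes "A \<in> carrier_mat n r" "B \<in> carrier_mat r m" "i < n" "j < m"
  shows "(A * B) $$ (i,j) = (\<Sum>k<r. A $$ (i,k) * B $$ (k,j))"
  using assms by (simp add: scalar_prod_def lessThan_atLeast0)

text \<open>For the matrix of modes restricted to a patch, these are the modes that are nonzero on
  the patch.\<close>

definition nz_cols :: "real mat \<Rightarrow> nat set" where
  "nz_cols G = {k. k < dim_col G \<and> (\<exists>a<dim_row G. G $$ (a,k) \<noteq> 0)}"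

text \<open>Both sides are the sum of the squared entries of \<open>U\<close>: the trace of
  \<open>U * U\<^sup>T\<close> is \<open>r\<close>, and the trace of \<open>U\<^sup>T * U\<close>
  counts \<open>S\<close>.\<close>

lemma card_of_coisometry:
  fixes U :: "real mat"
  assumes U: "U \<in> carrier_mat r K" and rows: "U * U\<^sup>T = 1\<^sub>m r"
    and cols: "\<And>j. j < K \<Longrightarrow> (U\<^sup>T * U) $$ (j,j) = (if j \<in> S then 1 else 0)"
    and S: "S \<subseteq> {..<K}"
  shows "card S = r"
proof -
  have "real r = (\<Sum>i<r. (U * U\<^sup>T) $$ (i,i))" unfolding rows by simp
  also have "\<dots> = (\<Sum>i<r. \<Sum>j<K. U $$ (i,j) * U $$ (i,j))"
    using U by (intro sum.cong refl) (subst mult_entry[of U r K "U\<^sup>T" r], auto)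
  also have "\<dots> = (\<Sum>j<K. \<Sum>i<r. U $$ (i,j) * U $$ (i,j))" by (rule sum.swap)
  also have "\<dots> = (\<Sum>j<K. (U\<^sup>T * U) $$ (j,j))"
    using U by (intro sum.cong refl) (subst mult_entry[of "U\<^sup>T" K r U K], auto)
  also have "\<dots> = (\<Sum>j<K. if j \<in> S then 1 else 0)" using cols by simp
  also have "\<dots> = real (card S)"
  proof -
    have "{..<K} \<inter> S = S" using S by auto
    then show ?thesis by (simp add: sum.If_cases)
  qed
  finally show ?thesis by simp
qed

text \<open>From \<open>H * U = G\<close> and \<open>U * U\<^sup>T = 1\<close> follows
  \<open>G * (U\<^sup>T * U) = G\<close>. Each column of \<open>U\<^sup>T * U - 1\<close> is
  therefore a linear relation between the columns of \<open>G\<close>, which vanishes at the nonzero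
  ones by independence; a zero column of \<open>G\<close> gives a zero column of \<open>U\<close>.
  So mere independence of the modes on a patch becomes orthonormality of the nonzero columns of
  \<open>U\<close>.\<close>

lemma left_inverse_mult_nz_cols:
  fixes G H X :: "real mat"
  assumes G: "G \<in> carrier_mat n K" and H: "H \<in> carrier_mat n r" and X: "X \<in> carrier_mat r n"
    and XH: "X * H = 1\<^sub>m r" and eq: "G * G\<^sup>T = H * H\<^sup>T"
    and indep: "\<forall>c. (\<forall>a<n. (\<Sum>k<K. G $$ (a,k) * c k) = 0) \<longrightarrow> (\<forall>k\<in>nz_cols G. c k = 0)"
  defines "U \<equiv> X * G"
  shows "\<And>j k. j < K \<Longrightarrow> k < K \<Longrightarrow>
           (U\<^sup>T * U) $$ (j,k) = (if j = k \<and> k \<in> nz_cols G then 1 else 0)"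
    and "\<And>i k. i < r \<Longrightarrow> k < K \<Longrightarrow> U $$ (i,k) \<noteq> 0 \<Longrightarrow> k \<in> nz_cols G"
    and "card (nz_cols G) = r"
proof -
  have U: "U \<in> carrier_mat r K" unfolding U_def using X G by simp
  note f = gram_eq_left_inverse[OF G H X XH eq, folded U_def]
  show off: "k \<in> nz_cols G" if "i < r" "k < K" "U $$ (i,k) \<noteq> 0" for i k
  proof (rule ccontr)
    assume "k \<notin> nz_cols G"
    then have "\<And>a. a < n \<Longrightarrow> G $$ (a,k) = 0" using that G by (auto simp: nz_cols_def)
    then have "U $$ (i,k) = 0" unfolding U_def using that mult_entry[OF X G that(1,2)] by simp
    with that show False by simp
  qed
  show UU: "(U\<^sup>T * U) $$ (j,k) = (if j = k \<and> k \<in> nz_cols G then 1 else 0)" if jk: "j < K" "k < K" for j k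
  proof (cases "j \<in> nz_cols G")
    case True
    have e: "G * (U\<^sup>T * U) = G"
    proof -
      have "G * (U\<^sup>T * U) = H * ((U * U\<^sup>T) * U)"
        by (subst f(2)[symmetric]) (use H U in \<open>simp add: assoc_mult_mat[of _ n r _ K _ K] assoc_mult_mat[of _ r K _ r _ K]\<close>)
      then show ?thesis using f U by simp
    qed
    \<comment> \<open>Column \<open>k\<close> of \<open>U\<^sup>T * U - 1\<close>, the coefficients
      of the relation.\<close>
    define c where "c = (\<lambda>j. (U\<^sup>T * U) $$ (j,k) - (if j = k then 1 else 0))"
    have "(\<Sum>l<K. G $$ (a,l) * c l) = 0" if a: "a < n" for a
    proof -
      have "(\<Sum>l<K. G $$ (a,l) * (U\<^sup>T * U) $$ (l,k)) = G $$ (a,k)"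
        using mult_entry[OF G, of "U\<^sup>T * U" K a k] U jk a e by simp
      moreover have "(\<Sum>l<K. G $$ (a,l) * (if l = k then 1 else 0)) = G $$ (a,k)"
        using jk by (simp add: if_distrib cong: if_cong)
      ultimately show ?thesis unfolding c_def by (simp add: right_diff_distrib sum_subtractf)
    qed
    then have "c j = 0" using indep True by blast
    then have "(U\<^sup>T * U) $$ (j,k) = (if j = k then 1 else 0)"
      unfolding c_def by simp
    then show ?thesis using True by auto
  next
    case False
    then have "\<And>i. i < r \<Longrightarrow> U $$ (i,j) = 0" using off jk by blast
    then have "(U\<^sup>T * U) $$ (j,k) = 0" using mult_entry[of "U\<^sup>T" K r U K j k] U jk by simp
    then show ?thesis using False by auto
  qed
  show "card (nz_cols G) = r"
    using card_of_coisometry[OF U f(1), of "nz_cols G"] UU G by (auto simp: nz_cols_def)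
qed

subsection \<open>Block diagonal matrices\<close>

lemma sum_lessThan_add:
  fixes f :: "nat \<Rightarrow> 'a::comm_monoid_add"
  shows "(\<Sum>r<a + b. f r) = (\<Sum>r<a. f r) + (\<Sum>i<b. f (a + i))"
  by (induction b) (simp_all add: add.assoc)

lemma sum_blocks:
  fixes f :: "nat \<Rightarrow> 'a::comm_monoid_add" and M :: nat
  shows "(\<Sum>r<sum s {..<M}. f r) = (\<Sum>m<M. \<Sum>i<s m. f (sum s {..<m} + i))"
  by (induction M) (simp_all add: sum_lessThan_add)

lemma block_pos_le:
  fixes s :: "nat \<Rightarrow> nat"
  shows "m < M \<Longrightarrow> sum s {..<m} + s m \<le> sum s {..<M}"
  using sum_mono2[of "{..<M}" "{..<Suc m}" s] by auto

lemma block_pos_less: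
  fixes s :: "nat \<Rightarrow> nat"
  shows "m < M \<Longrightarrow> i < s m \<Longrightarrow> sum s {..<m} + i < sum s {..<M}"
  using block_pos_le[of m M s] by simp

lemma block_posE:
  fixes s :: "nat \<Rightarrow> nat"
  assumes "r < sum s {..<M}"
  obtains m i where "m < M" "i < s m" "r = sum s {..<m} + i"
proof -
  have "\<exists>m<M. \<exists>i<s m. r = sum s {..<m} + i"
    using assms
  proof (induction M)
    case (Suc M)
    show ?case
    proof (cases "r < sum s {..<M}")
      case True
      then show ?thesis using Suc.IH less_SucI by blast
    next
      case False
      then have "r - sum s {..<M} < s M" "r = sum s {..<M} + (r - sum s {..<M})"
        using Suc.prems by auto
      then show ?thesis by blast
    qed
  qed simp
  then show thesis using that by blast
qed

text \<open>Used to stack the matrices \<open>U m\<close> into one tall matrix whose rows are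
  addressed by block and offset only.\<close>

lemma block_function_exists:
  fixes s :: "nat \<Rightarrow> nat"
  shows "\<exists>f. \<forall>m<M. \<forall>i<s m. f (sum s {..<m} + i) = g m i"
proof (induction M)
  case (Suc M)
  then obtain f where f: "\<forall>m<M. \<forall>i<s m. f (sum s {..<m} + i) = g m i" by blast
  define f' where "f' = (\<lambda>r. if r < sum s {..<M} then f r else g M (r - sum s {..<M}))"
  have "f' (sum s {..<m} + i) = g m i" if "m < Suc M" "i < s m" for m i
    using that f block_pos_less[of m M i s] by (cases "m = M") (auto simp: f'_def)
  then show ?case by blast
qed simp

text \<open>Dimensions and entries go through one induction, because locating an entry relative to
  the last block requires the dimensions of the part before it.\<close>

lemma diag_block_mat_entry:
  fixes B :: "nat \<Rightarrow> 'a::zero mat"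
  assumes "\<And>m. m < M \<Longrightarrow> B m \<in> carrier_mat (r m) (c m)"
  shows "diag_block_mat (map B [0..<M]) \<in> carrier_mat (sum r {..<M}) (sum c {..<M})"
    and "\<And>m n i j. m < M \<Longrightarrow> n < M \<Longrightarrow> i < r m \<Longrightarrow> j < c n \<Longrightarrow>
      diag_block_mat (map B [0..<M]) $$ (sum r {..<m} + i, sum c {..<n} + j) =
      (if m = n then B m $$ (i, j) else 0)"
proof -
  have "diag_block_mat (map B [0..<M]) \<in> carrier_mat (sum r {..<M}) (sum c {..<M}) \<and>
    (\<forall>m<M. \<forall>n<M. \<forall>i<r m. \<forall>j<c n.
      diag_block_mat (map B [0..<M]) $$ (sum r {..<m} + i, sum c {..<n} + j) =
      (if m = n then B m $$ (i, j) else 0))"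
    using assms
  proof (induction M)
    case (Suc M)
    define X where "X = diag_block_mat (map B [0..<M])"
    have X: "X \<in> carrier_mat (sum r {..<M}) (sum c {..<M})"
      and Xe: "\<And>m n i j. m < M \<Longrightarrow> n < M \<Longrightarrow> i < r m \<Longrightarrow> j < c n \<Longrightarrow>
         X $$ (sum r {..<m} + i, sum c {..<n} + j) = (if m = n then B m $$ (i, j) else 0)"
      using Suc unfolding X_def by auto
    have BM: "B M \<in> carrier_mat (r M) (c M)" using Suc.prems by auto
    have eq: "diag_block_mat (map B [0..<Suc M]) =
        four_block_mat X (0\<^sub>m (sum r {..<M}) (c M)) (0\<^sub>m (r M) (sum c {..<M})) (B M)"
      using X BM by (simp add: diag_block_mat_last X_def Let_def)
    have "diag_block_mat (map B [0..<Suc M]) \<in> carrier_mat (sum r {..<Suc M}) (sum c {..<Suc M})"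
      unfolding eq using X BM by auto
    moreover have "diag_block_mat (map B [0..<Suc M]) $$ (sum r {..<m} + i, sum c {..<n} + j) =
      (if m = n then B m $$ (i, j) else 0)" if mn: "m < Suc M" "n < Suc M" "i < r m" "j < c n" for m n i j
    proof -
      have i: "if m < M then sum r {..<m} + i < sum r {..<M} else m = M"
        using mn block_pos_less[of m M i r] by auto
      have j: "if n < M then sum c {..<n} + j < sum c {..<M} else n = M"
        using mn block_pos_less[of n M j c] by auto
      show ?thesis unfolding eq
        by (subst index_mat_four_block) (use i j X BM mn Xe in \<open>auto split: if_splits\<close>)
    qed
    ultimately show ?case by blast
  qed simp
  then show "diag_block_mat (map B [0..<M]) \<in> carrier_mat (sum r {..<M}) (sum c {..<M})"
    and "\<And>m n i j. m < M \<Longrightarrow> n < M \<Longrightarrow> i < r m \<Longrightarrow> j < c n \<Longrightarrow>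
      diag_block_mat (map B [0..<M]) $$ (sum r {..<m} + i, sum c {..<n} + j) =
      (if m = n then B m $$ (i, j) else 0)" by blast+
qed

lemma diag_block_mat_mult_entry:
  fixes B :: "nat \<Rightarrow> 'a::comm_semiring_1 mat"
  assumes B: "\<And>m. m < M \<Longrightarrow> B m \<in> carrier_mat (r m) (c m)"
    and X: "X \<in> carrier_mat (sum c {..<M}) K"
    and m: "m < M" "i < r m" "k < K"
  shows "(diag_block_mat (map B [0..<M]) * X) $$ (sum r {..<m} + i, k) =
    (\<Sum>j<c m. B m $$ (i,j) * X $$ (sum c {..<m} + j, k))"
proof -
  note d = diag_block_mat_entry[of M B r c, OF B]
  have "(diag_block_mat (map B [0..<M]) * X) $$ (sum r {..<m} + i, k) =
     (\<Sum>n<M. \<Sum>j<c n. diag_block_mat (map B [0..<M]) $$ (sum r {..<m} + i, sum c {..<n} + j)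
        * X $$ (sum c {..<n} + j, k))"
    by (rule trans[OF mult_entry[OF d(1) X block_pos_less[where s=r, OF m(1,2)] m(3)] sum_blocks])
  also have "\<dots> = (\<Sum>n<M. if n = m then (\<Sum>j<c m. B m $$ (i,j) * X $$ (sum c {..<m} + j, k)) else 0)"
    using m by (intro sum.cong refl) (auto simp: d(2))
  finally show ?thesis using m by simp
qed

lemma diag_block_mat_transpose_mult_entry:
  fixes B :: "nat \<Rightarrow> 'a::comm_semiring_1 mat"
  assumes B: "\<And>m. m < M \<Longrightarrow> B m \<in> carrier_mat (r m) (c m)"
    and X: "X \<in> carrier_mat (sum r {..<M}) K"
    and m: "m < M" "j < c m" "k < K"
  shows "((diag_block_mat (map B [0..<M]))\<^sup>T * X) $$ (sum c {..<m} + j, k) =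
    (\<Sum>i<r m. B m $$ (i,j) * X $$ (sum r {..<m} + i, k))"
proof -
  let ?D = "diag_block_mat (map B [0..<M])"
  note d = diag_block_mat_entry[of M B r c, OF B]
  have j: "sum c {..<m} + j < sum c {..<M}" using m by (intro block_pos_less)
  have Dt: "?D\<^sup>T \<in> carrier_mat (sum c {..<M}) (sum r {..<M})" using d(1) by simp
  have "(?D\<^sup>T * X) $$ (sum c {..<m} + j, k) =
     (\<Sum>n<M. \<Sum>i<r n. ?D\<^sup>T $$ (sum c {..<m} + j, sum r {..<n} + i) * X $$ (sum r {..<n} + i, k))"
    by (rule trans[OF mult_entry[OF Dt X j m(3)] sum_blocks])
  also have "\<dots> = (\<Sum>n<M. if n = m then (\<Sum>i<r m. B m $$ (i,j) * X $$ (sum r {..<m} + i, k)) else 0)"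
  proof (intro sum.cong refl)
    fix n assume n: "n \<in> {..<M}"
    have "?D\<^sup>T $$ (sum c {..<m} + j, sum r {..<n} + i) = (if n = m then B m $$ (i,j) else 0)"
      if "i < r n" for i
      using d(1) d(2)[of n m i j] that n m j block_pos_less[of n M i r] by auto
    then show "(\<Sum>i<r n. ?D\<^sup>T $$ (sum c {..<m} + j, sum r {..<n} + i) * X $$ (sum r {..<n} + i, k)) =
      (if n = m then (\<Sum>i<r m. B m $$ (i,j) * X $$ (sum r {..<m} + i, k)) else 0)"
      by simp
  qed
  finally show ?thesis using m by simp
qed

subsection \<open>Cholesky factors and classes of columns\<close>

text \<open>
  The leading square blocks of \<open>E\<close> and \<open>L\<close> have the same determinant up to sign.
\<close>

lemma lower_trapezoidal_gram_column_nonzero: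
  fixes E L :: "real mat"
  assumes E: "E \<in> carrier_mat s K" and L: "L \<in> carrier_mat s K" and "K \<le> s"
    and lower: "\<And>i j. i < s \<Longrightarrow> j < K \<Longrightarrow> i < j \<Longrightarrow> L $$ (i,j) = 0"
    and pos: "\<And>j. j < K \<Longrightarrow> 0 < L $$ (j,j)"
    and eq: "E * E\<^sup>T = L * L\<^sup>T" and k: "k < K"
  shows "\<exists>r<s. E $$ (r,k) \<noteq> 0"
proof (rule ccontr)
  assume "\<not> (\<exists>r<s. E $$ (r,k) \<noteq> 0)"
  then have 0: "\<And>r. r < s \<Longrightarrow> E $$ (r,k) = 0" by blast
  \<comment> \<open>The first \<open>K\<close> rows. The leading \<open>K\<close> by
    \<open>K\<close> block of \<open>X * X\<^sup>T\<close> depends on these rows only, so the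
    squared determinant of \<open>top X\<close> can be read off the Gram matrix.\<close>
  define top :: "real mat \<Rightarrow> real mat" where "top = (\<lambda>X. mat K K (\<lambda>(i,j). X $$ (i,j)))"
  have top: "top X \<in> carrier_mat K K" for X unfolding top_def by simp
  have gram: "top X * (top X)\<^sup>T = mat K K (\<lambda>(i,j). (X * X\<^sup>T) $$ (i,j))" if X: "X \<in> carrier_mat s K" for X
  proof (rule eq_matI)
    fix i j assume "i < dim_row (mat K K (\<lambda>(i,j). (X * X\<^sup>T) $$ (i,j)))" "j < dim_col (mat K K (\<lambda>(i,j). (X * X\<^sup>T) $$ (i,j)))"
    then have ij: "i < K" "j < K" by auto
    then have "i < s" "j < s" using \<open>K \<le> s\<close> by auto
    then show "(top X * (top X)\<^sup>T) $$ (i,j) = mat K K (\<lambda>(i,j). (X * X\<^sup>T) $$ (i,j)) $$ (i,j)"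
      using ij X by (simp add: scalar_prod_def top_def)
  qed (simp_all add: top_def)
  have sq: "(det (top X))\<^sup>2 = det (top X * (top X)\<^sup>T)" for X
    using det_mult[OF top, of "(top X)\<^sup>T" X] det_transpose[OF top] by (simp add: power2_eq_square top)
  \<comment> \<open>A zero column \<open>k\<close> puts \<open>unit_vec K k\<close> into the kernel,
    whereas \<open>top L\<close> is triangular with positive diagonal.\<close>
  have "det (top E) = 0"
  proof (subst det_0_iff_vec_prod_zero_field[OF top], intro exI conjI)
    show "unit_vec K k \<in> carrier_vec K" by simp
    show "unit_vec K k \<noteq> (0\<^sub>v K :: real vec)"
    proof
      assume "unit_vec K k = (0\<^sub>v K :: real vec)"
      then have "unit_vec K k $ k = (0\<^sub>v K :: real vec) $ k" by simp
      with k show False by simp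
    qed
    show "top E *\<^sub>v unit_vec K k = 0\<^sub>v K"
    proof (rule eq_vecI)
      fix i assume "i < dim_vec (0\<^sub>v K :: real vec)"
      then have i: "i < K" by simp
      then have "E $$ (i,k) = 0" using 0 \<open>K \<le> s\<close> by simp
      then show "(top E *\<^sub>v unit_vec K k) $ i = 0\<^sub>v K $ i"
        using i k by (simp add: top_def)
    qed (simp add: top_def)
  qed
  then have "(det (top L))\<^sup>2 = 0" unfolding sq gram[OF L] eq[symmetric] gram[OF E, symmetric]
    by (simp flip: sq)
  moreover have "det (top L) = prod_list (diag_mat (top L))"
    using \<open>K \<le> s\<close> by (intro det_lower_triangular[OF _ top]) (auto simp: top_def lower)
  moreover have "prod_list (diag_mat (top L)) \<noteq> 0"
    unfolding prod_list_zero_iff by (auto simp: diag_mat_def top_def dest!: pos)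
  ultimately show False by simp
qed

text \<open>
  By induction on the column \<open>k\<close>: the contributions of earlier columns to the entry \<open>(r, k)\<close> of
  \<open>L L\<^sup>T = E E\<^sup>T\<close> vanish when the rows \<open>r\<close> and \<open>k\<close> have different classes, and so does the entry.
\<close>

lemma lower_trapezoidal_columns_one_class:
  fixes E L :: "real mat" and cl :: "nat \<Rightarrow> 'a"
  assumes E: "E \<in> carrier_mat s K" and L: "L \<in> carrier_mat s K" and "K \<le> s"
    and lower: "\<And>i j. i < s \<Longrightarrow> j < K \<Longrightarrow> i < j \<Longrightarrow> L $$ (i,j) = 0"
    and pos: "\<And>j. j < K \<Longrightarrow> 0 < L $$ (j,j)"
    and eq: "E * E\<^sup>T = L * L\<^sup>T"
    and cl: "\<And>r j k. r < s \<Longrightarrow> j < K \<Longrightarrow> k < K \<Longrightarrow> E $$ (r,j) \<noteq> 0 \<Longrightarrow> E $$ (r,k) \<noteq> 0 \<Longrightarrow> cl j = cl k"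
  defines "T \<equiv> \<lambda>r. cl ` {k. k < K \<and> E $$ (r,k) \<noteq> 0}"
  shows "k < K \<Longrightarrow> r < s \<Longrightarrow> L $$ (r,k) \<noteq> 0 \<Longrightarrow> T r = T k"
proof (induction k arbitrary: r rule: less_induct)
  case (less k)
  have ks: "k < s" using less.prems \<open>K \<le> s\<close> by simp
  show ?case
  proof (rule ccontr)
    assume ne: "T r \<noteq> T k"
    have "(L * L\<^sup>T) $$ (r,k) = (\<Sum>l<K. L $$ (r,l) * L $$ (k,l))"
      using L less.prems ks by (subst mult_entry[OF L, of "L\<^sup>T" s]) auto
    also have "\<dots> = (\<Sum>l<K. if l = k then L $$ (r,k) * L $$ (k,k) else 0)"
    proof (intro sum.cong refl)
      fix l assume l: "l \<in> {..<K}"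
      consider "l = k" | "l < k" | "k < l" by linarith
      then show "L $$ (r,l) * L $$ (k,l) = (if l = k then L $$ (r,k) * L $$ (k,k) else 0)"
      proof cases
        case 2
        \<comment> \<open>If both entries were nonzero, the induction hypothesis for column
          \<open>l\<close> would give \<open>T r = T l = T k\<close>.\<close>
        then have "L $$ (r,l) = 0 \<or> L $$ (k,l) = 0"
          using less.IH[OF 2, of r] less.IH[OF 2, of k] ne less.prems ks l by auto
        then show ?thesis using 2 by auto
      qed (use lower[of k l] ks l in auto)
    qed
    finally have "(L * L\<^sup>T) $$ (r,k) \<noteq> 0" using less.prems pos[of k] by simp
    moreover have "(E * E\<^sup>T) $$ (r,k) = (\<Sum>l<K. E $$ (r,l) * E $$ (k,l))"
      using E less.prems ks by (subst mult_entry[OF E, of "E\<^sup>T" s]) auto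
    ultimately have "(\<Sum>l<K. E $$ (r,l) * E $$ (k,l)) \<noteq> 0" using eq by simp
    then obtain l where "l < K" "E $$ (r,l) * E $$ (k,l) \<noteq> 0"
      by (metis (no_types, lifting) lessThan_iff sum.neutral)
    then have l: "l < K" "E $$ (r,l) \<noteq> 0" "E $$ (k,l) \<noteq> 0" by auto
    \<comment> \<open>A row that meets column \<open>l\<close> has the class of \<open>l\<close> and
      no other. Rows \<open>r\<close> and \<open>k\<close> both meet it, so their class sets
      agree.\<close>
    have "T q = {cl l}" if q: "q < s" "E $$ (q,l) \<noteq> 0" for q
    proof (intro equalityI subsetI)
      fix x assume "x \<in> T q"
      then obtain j where j: "j < K" "E $$ (q,j) \<noteq> 0" "x = cl j" unfolding T_def by blast
      then show "x \<in> {cl l}" using cl[OF q(1) j(1) l(1) j(2) q(2)] by simp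
    qed (use q l in \<open>auto simp: T_def\<close>)
    from this[OF less.prems(2) l(2)] this[OF ks l(3)]
    show False using ne by simp
  qed
qed

text \<open>The columns of \<open>E\<close> are pairwise orthogonal and nonzero, so transposing
  \<open>E\<close> and dividing by the squared column norms gives a left inverse \<open>X\<close>;
  take \<open>W = X * L\<close>. A nonzero entry \<open>(j, k)\<close> of \<open>W\<close> needs a
  row \<open>r\<close> in which column \<open>j\<close> of \<open>E\<close> and column
  \<open>k\<close> of \<open>L\<close> are both nonzero. The class of row \<open>r\<close> is then
  that of \<open>j\<close> and also that of row \<open>k\<close>, so column \<open>k\<close> of
  \<open>W\<close> involves a single class.\<close>

lemma trapezoidal_factor_rotation:
  fixes E L :: "real mat" and cl :: "nat \<Rightarrow> 'a"
  assumes E: "E \<in> carrier_mat s K" and L: "L \<in> carrier_mat s K" and "K \<le> s"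
    and lower: "\<And>i j. i < s \<Longrightarrow> j < K \<Longrightarrow> i < j \<Longrightarrow> L $$ (i,j) = 0"
    and pos: "\<And>j. j < K \<Longrightarrow> 0 < L $$ (j,j)"
    and eq: "E * E\<^sup>T = L * L\<^sup>T"
    and EtE: "\<And>j k. j < K \<Longrightarrow> k < K \<Longrightarrow> j \<noteq> k \<Longrightarrow> (E\<^sup>T * E) $$ (j,k) = 0"
    and cl: "\<And>r j k. r < s \<Longrightarrow> j < K \<Longrightarrow> k < K \<Longrightarrow> E $$ (r,j) \<noteq> 0 \<Longrightarrow> E $$ (r,k) \<noteq> 0 \<Longrightarrow> cl j = cl k"
  obtains W where "W \<in> carrier_mat K K" "W * W\<^sup>T = 1\<^sub>m K" "L = E * W"
    "\<And>j j' k. j < K \<Longrightarrow> j' < K \<Longrightarrow> k < K \<Longrightarrow> W $$ (j,k) \<noteq> 0 \<Longrightarrow> W $$ (j',k) \<noteq> 0 \<Longrightarrow> cl j = cl j'"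
proof -
  define d where "d = (\<lambda>k. (E\<^sup>T * E) $$ (k,k))"
  have EtE_sum: "(E\<^sup>T * E) $$ (j,k) = (\<Sum>r<s. E $$ (r,j) * E $$ (r,k))" if "j < K" "k < K" for j k
    using E that by (subst mult_entry[of "E\<^sup>T" K s E K]) auto
  have d: "d k \<noteq> 0" if k: "k < K" for k
  proof
    assume "d k = 0"
    then have "(\<Sum>r<s. E $$ (r,k) * E $$ (r,k)) = 0" using EtE_sum[of k k] k by (simp add: d_def)
    then have "\<And>r. r < s \<Longrightarrow> E $$ (r,k) = 0"
      using sum_nonneg_eq_0_iff[of "{..<s}" "\<lambda>r. E $$ (r,k) * E $$ (r,k)"] by auto
    then show False
      using lower_trapezoidal_gram_column_nonzero[OF E L \<open>K \<le> s\<close> lower pos eq k] by blast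
  qed
  define X where "X = mat K s (\<lambda>(k,r). E $$ (r,k) / d k)"
  have X: "X \<in> carrier_mat K s" unfolding X_def by simp
  have XE: "X * E = 1\<^sub>m K"
  proof (rule eq_matI)
    fix j k assume "j < dim_row (1\<^sub>m K :: real mat)" "k < dim_col (1\<^sub>m K :: real mat)"
    then have jk: "j < K" "k < K" by auto
    have "(X * E) $$ (j,k) = (\<Sum>r<s. E $$ (r,j) / d j * E $$ (r,k))"
      using jk by (subst mult_entry[OF X E]) (auto simp: X_def)
    also have "\<dots> = (E\<^sup>T * E) $$ (j,k) / d j"
      unfolding EtE_sum[OF jk] by (simp add: sum_divide_distrib)
    also have "\<dots> = 1\<^sub>m K $$ (j,k)" using jk d[OF jk(1)] EtE[OF jk] by (auto simp: d_def)
    finally show "(X * E) $$ (j,k) = 1\<^sub>m K $$ (j,k)" .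
  qed (use X E in auto)
  \<comment> \<open>Here \<open>L\<close> is compared with \<open>E\<close>: \<open>X * L\<close>
    has orthonormal rows and \<open>E * (X * L) = L\<close>.\<close>
  note W = gram_eq_left_inverse[OF L E X XE eq[symmetric]]
  define T where "T = (\<lambda>r. cl ` {k. k < K \<and> E $$ (r,k) \<noteq> 0})"
  have one: "cl j \<in> T k \<and> (\<forall>x\<in>T k. x = cl j)" if jk: "j < K" "k < K" "(X * L) $$ (j,k) \<noteq> 0" for j k
  proof -
    have "(X * L) $$ (j,k) = (\<Sum>r<s. E $$ (r,j) / d j * L $$ (r,k))"
      using jk by (subst mult_entry[OF X L]) (auto simp: X_def)
    with jk obtain r where "r < s" "E $$ (r,j) / d j * L $$ (r,k) \<noteq> 0"
      by (metis (no_types, lifting) lessThan_iff sum.neutral)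
    then have r: "r < s" "E $$ (r,j) \<noteq> 0" "L $$ (r,k) \<noteq> 0" by auto
    have "T r = T k" unfolding T_def
      by (rule lower_trapezoidal_columns_one_class[OF E L \<open>K \<le> s\<close> lower pos eq cl jk(2) r(1,3)])
    moreover have "T r = {cl j}"
    proof (intro equalityI subsetI)
      fix x assume "x \<in> T r"
      then obtain l where l: "l < K" "E $$ (r,l) \<noteq> 0" "x = cl l" unfolding T_def by blast
      then show "x \<in> {cl j}" using cl[OF r(1) l(1) jk(1) l(2) r(2)] by simp
    qed (use r jk in \<open>auto simp: T_def\<close>)
    ultimately show ?thesis by (metis singletonD singletonI)
  qed
  show thesis
  proof (rule that[of "X * L"])
    show "cl j = cl j'" if "j < K" "j' < K" "k < K" "(X * L) $$ (j,k) \<noteq> 0" "(X * L) $$ (j',k) \<noteq> 0" for j j' k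
      using one[of j k] one[of j' k] that by metis
  qed (use X L W in auto)
qed

text \<open>Pivoting only permutes rows: \<open>Q\<^sup>T * E\<close> has Gram matrix
  \<open>L * L\<^sup>T\<close>, the same column products as \<open>E\<close>, and the rows of
  \<open>E\<close> in another order. Multiplying its factorization by \<open>Q\<close> leads back to
  \<open>E\<close>.\<close>

lemma pivoted_cholesky_rotation:
  fixes E :: "real mat" and cl :: "nat \<Rightarrow> 'a"
  assumes E: "E \<in> carrier_mat s K" and chol: "pivoted_cholesky (E * E\<^sup>T) K Q L"
    and EtE: "\<And>j k. j < K \<Longrightarrow> k < K \<Longrightarrow> j \<noteq> k \<Longrightarrow> (E\<^sup>T * E) $$ (j,k) = 0"
    and cl: "\<And>r j k. r < s \<Longrightarrow> j < K \<Longrightarrow> k < K \<Longrightarrow> E $$ (r,j) \<noteq> 0 \<Longrightarrow> E $$ (r,k) \<noteq> 0 \<Longrightarrow> cl j = cl k"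
  obtains W where "W \<in> carrier_mat K K" "W * W\<^sup>T = 1\<^sub>m K" "Q * L = E * W"
    "\<And>j j' k. j < K \<Longrightarrow> j' < K \<Longrightarrow> k < K \<Longrightarrow> W $$ (j,k) \<noteq> 0 \<Longrightarrow> W $$ (j',k) \<noteq> 0 \<Longrightarrow> cl j = cl j'"
    "Q \<in> carrier_mat s s" "L \<in> carrier_mat s K"
proof -
  from chol E obtain \<pi> where \<pi>: "\<pi> permutes {..<s}" and Qdef: "Q = mat s s (\<lambda>(i, j). if i = \<pi> j then 1 else 0)"
    and "K \<le> s" and L: "L \<in> carrier_mat s K"
    and lower: "\<And>i j. i < s \<Longrightarrow> j < K \<Longrightarrow> i < j \<Longrightarrow> L $$ (i,j) = 0"
    and pos: "\<And>j. j < K \<Longrightarrow> 0 < L $$ (j,j)"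
    and eq: "E * E\<^sup>T = Q * L * L\<^sup>T * Q\<^sup>T"
    unfolding pivoted_cholesky_def by (auto simp: Let_def)
  have Q: "Q \<in> carrier_mat s s" by (simp add: Qdef)
  have \<pi>s: "\<pi> j < s" if "j < s" for j using permutes_in_image[OF \<pi>, of j] that by simp
  have QtQ: "Q\<^sup>T * Q = 1\<^sub>m s"
  proof (rule eq_matI)
    fix i j assume "i < dim_row (1\<^sub>m s :: real mat)" "j < dim_col (1\<^sub>m s :: real mat)"
    then have ij: "i < s" "j < s" by auto
    have "(Q\<^sup>T * Q) $$ (i,j) = (\<Sum>k<s. Q\<^sup>T $$ (i,k) * Q $$ (k,j))"
      using ij Q by (intro mult_entry) auto
    also have "\<dots> = (\<Sum>k<s. if k = \<pi> j then (if i = j then 1 else 0) else 0)"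
      using ij permutes_inj[OF \<pi>] by (intro sum.cong refl) (auto simp: Qdef dest: injD)
    finally have "(Q\<^sup>T * Q) $$ (i,j) = (\<Sum>k<s. if k = \<pi> j then (if i = j then 1 else 0) else 0)" .
    then show "(Q\<^sup>T * Q) $$ (i,j) = 1\<^sub>m s $$ (i,j)" using ij \<pi>s by simp
  qed (use Q in auto)
  have QQt: "Q * Q\<^sup>T = 1\<^sub>m s" using mat_mult_left_right_inverse[OF _ Q QtQ] Q by simp
  define E' where "E' = Q\<^sup>T * E"
  have E': "E' \<in> carrier_mat s K" unfolding E'_def using Q E by simp
  have QE': "Q * E' = E"
    unfolding E'_def using Q E QQt assoc_mult_mat[of Q s s "Q\<^sup>T" s E K] by simp
  have E't: "E'\<^sup>T = E\<^sup>T * Q" unfolding E'_def using Q E by (subst transpose_mult[of _ s s]) auto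
  have entry: "E' $$ (r,k) = E $$ (\<pi> r, k)" if "r < s" "k < K" for r k
  proof -
    have "E' $$ (r,k) = (\<Sum>l<s. Q\<^sup>T $$ (r,l) * E $$ (l,k))"
      unfolding E'_def using that Q E by (intro mult_entry) auto
    also have "\<dots> = (\<Sum>l<s. if l = \<pi> r then E $$ (l,k) else 0)"
      using that by (intro sum.cong refl) (auto simp: Qdef)
    finally have "E' $$ (r,k) = (\<Sum>l<s. if l = \<pi> r then E $$ (l,k) else 0)" .
    then show ?thesis using \<pi>s that by simp
  qed
  have "E' * E'\<^sup>T = Q\<^sup>T * (E * E\<^sup>T) * Q" unfolding E't unfolding E'_def
    using Q E by (simp add: assoc_mult_mat[of _ s s _ s _ s] assoc_mult_mat[of _ s s _ K _ s] assoc_mult_mat[of _ s K _ s _ s])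
  also have "\<dots> = (Q\<^sup>T * Q) * (L * L\<^sup>T) * (Q\<^sup>T * Q)" unfolding eq
    using Q L by (simp add: assoc_mult_mat[of _ s s _ s _ s] assoc_mult_mat[of _ s s _ K _ s] assoc_mult_mat[of _ s K _ s _ s])
  finally have gram: "E' * E'\<^sup>T = L * L\<^sup>T" unfolding QtQ using L by simp
  have "E'\<^sup>T * E' = E\<^sup>T * (Q * E')" unfolding E't
    using Q E E' by (simp add: assoc_mult_mat[of _ K s _ s _ K])
  then have EtE': "E'\<^sup>T * E' = E\<^sup>T * E" using QE' by simp
  have A: "(E'\<^sup>T * E') $$ (j,k) = 0" if "j < K" "k < K" "j \<noteq> k" for j k
    unfolding EtE' using EtE that by blast
  have B: "cl j = cl k" if "r < s" "j < K" "k < K" "E' $$ (r,j) \<noteq> 0" "E' $$ (r,k) \<noteq> 0" for r j k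
    using cl[of "\<pi> r" j k] that entry \<pi>s by simp
  obtain W where W: "W \<in> carrier_mat K K" "W * W\<^sup>T = 1\<^sub>m K" "L = E' * W"
    "\<And>j j' k. j < K \<Longrightarrow> j' < K \<Longrightarrow> k < K \<Longrightarrow> W $$ (j,k) \<noteq> 0 \<Longrightarrow> W $$ (j',k) \<noteq> 0 \<Longrightarrow> cl j = cl j'"
    by (rule trapezoidal_factor_rotation[where cl = cl, OF E' L \<open>K \<le> s\<close> _ _ gram])
      (erule (2) lower, erule pos, erule (2) A, erule (4) B, erule that, assumption, assumption, blast)
  have "Q * L = Q * E' * W" unfolding W(3) using Q E' W(1) by (simp add: assoc_mult_mat[of _ s s _ K _ K])
  then have "Q * L = E * W" using QE' by simp
  with W Q L show thesis using that by blast
qed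

subsection \<open>Joint diagonalization on the patches\<close>

lemma real_orthogonalD:
  assumes "real_orthogonal n V"
  shows "V \<in> carrier_mat n n" "V\<^sup>T * V = 1\<^sub>m n" "V * V\<^sup>T = 1\<^sub>m n"
proof -
  show V: "V \<in> carrier_mat n n" and VtV: "V\<^sup>T * V = 1\<^sub>m n" using assms unfolding real_orthogonal_def by blast+
  show "V * V\<^sup>T = 1\<^sub>m n" by (rule mat_mult_left_right_inverse[OF _ V VtV]) (use V in simp)
qed

lemma off_diag_sq_nonneg: "0 \<le> off_diag_sq k B"
  unfolding off_diag_sq_def by (intro sum_nonneg) auto

lemma off_diag_sq_eq_0_iff:
  "off_diag_sq k B = 0 \<longleftrightarrow> (\<forall>i<k. \<forall>j<k. i \<noteq> j \<longrightarrow> B $$ (i,j) = 0)"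
proof
  assume 0: "off_diag_sq k B = 0"
  have "(\<Sum>j\<in>{..<k} - {i}. \<bar>B $$ (i,j)\<bar>\<^sup>2) = 0" if "i < k" for i
    using 0 that unfolding off_diag_sq_def
    by (subst (asm) sum_nonneg_eq_0_iff) (auto intro!: sum_nonneg)
  then show "\<forall>i<k. \<forall>j<k. i \<noteq> j \<longrightarrow> B $$ (i,j) = 0"
    by (subst (asm) sum_nonneg_eq_0_iff) auto
qed (auto simp: off_diag_sq_def)

text \<open>With \<open>Y = V\<^sup>T * U\<close> the matrix is
  \<open>Y * (W\<^sup>T * W) * Y\<^sup>T\<close>, and \<open>W\<^sup>T * W\<close> is the coordinate
  projection onto \<open>S\<close>.\<close>

lemma conj_gram_entry:
  fixes V U W :: "real mat"
  assumes V: "V \<in> carrier_mat r r" and U: "U \<in> carrier_mat r K" and W: "W \<in> carrier_mat q K"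
    and cols: "\<And>j k. j < K \<Longrightarrow> k < K \<Longrightarrow> (W\<^sup>T * W) $$ (j,k) = (if j = k \<and> k \<in> S then 1 else 0)"
    and ij: "i < r" "j < r"
  shows "(V\<^sup>T * ((U * W\<^sup>T) * (U * W\<^sup>T)\<^sup>T) * V) $$ (i,j) =
    (\<Sum>k<K. (V\<^sup>T * U) $$ (i,k) * (if k \<in> S then (V\<^sup>T * U) $$ (j,k) else 0))"
proof -
  define Y where "Y = V\<^sup>T * U"
  have Y: "Y \<in> carrier_mat r K" unfolding Y_def using V U by simp
  have Yt: "Y\<^sup>T = U\<^sup>T * V" unfolding Y_def using V U by (subst transpose_mult[of _ r r]) auto
  have UWt: "(U * W\<^sup>T)\<^sup>T = W * U\<^sup>T" using U W by (subst transpose_mult[of _ r K]) auto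
  have "V\<^sup>T * ((U * W\<^sup>T) * (U * W\<^sup>T)\<^sup>T) * V = Y * ((W\<^sup>T * W) * Y\<^sup>T)"
    unfolding UWt Yt unfolding Y_def using U V W
    by (simp add: assoc_mult_mat[of _ r r _ r _ r] assoc_mult_mat[of _ r r _ K _ r]
        assoc_mult_mat[of _ r K _ r _ r] assoc_mult_mat[of _ r K _ q _ r]
        assoc_mult_mat[of _ q K _ r _ r] assoc_mult_mat[of _ K q _ K _ r]
        assoc_mult_mat[of _ r r _ q _ r] assoc_mult_mat[of _ r q _ K _ r]
        assoc_mult_mat[of _ r q _ r _ r] assoc_mult_mat[of _ K q _ r _ r])
  moreover have "(Y * ((W\<^sup>T * W) * Y\<^sup>T)) $$ (i,j) = (\<Sum>k<K. Y $$ (i,k) * ((W\<^sup>T * W) * Y\<^sup>T) $$ (k,j))"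
    using Y W ij by (intro mult_entry[of _ r K _ r]) auto
  moreover have "((W\<^sup>T * W) * Y\<^sup>T) $$ (k,j) = (if k \<in> S then Y $$ (j,k) else 0)" if k: "k < K" for k
  proof -
    have "((W\<^sup>T * W) * Y\<^sup>T) $$ (k,j) = (\<Sum>l<K. (W\<^sup>T * W) $$ (k,l) * Y\<^sup>T $$ (l,j))"
      using Y W ij k by (intro mult_entry[of _ K K _ r]) auto
    also have "\<dots> = (\<Sum>l<K. if l = k then (if k \<in> S then Y $$ (j,k) else 0) else 0)"
      using Y ij k by (intro sum.cong refl) (simp add: cols)
    finally show ?thesis using k by simp
  qed
  ultimately show ?thesis unfolding Y_def by simp
qed

text \<open>The columns of \<open>U m\<close> with index in \<open>S m\<close> are
  \<open>r m\<close> orthonormal vectors in dimension \<open>r m\<close>, so they form an orthogonal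
  \<open>V\<close>. The rows of \<open>V\<^sup>T * U m\<close> are then distinct unit vectors, and
  the same \<open>V\<close> diagonalizes the matrices for all \<open>n\<close> at once.\<close>

lemma joint_diagonalizer_exists:
  fixes U :: "nat \<Rightarrow> real mat"
  assumes U: "\<And>n. n < M \<Longrightarrow> U n \<in> carrier_mat (r n) K"
    and cols: "\<And>n j k. n < M \<Longrightarrow> j < K \<Longrightarrow> k < K \<Longrightarrow>
      ((U n)\<^sup>T * U n) $$ (j,k) = (if j = k \<and> k \<in> S n then 1 else 0)"
    and card: "card (S m) = r m" and S: "S m \<subseteq> {..<K}" and m: "m < M"
  obtains V where "real_orthogonal (r m) V"
    "(\<Sum>n<M. off_diag_sq (r m) (V\<^sup>T * ((U m * (U n)\<^sup>T) * (U m * (U n)\<^sup>T)\<^sup>T) * V)) = 0"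
proof -
  have "finite (S m)" using S finite_subset by blast
  then obtain f where f: "bij_betw f {0..<r m} (S m)" using ex_bij_betw_nat_finite card by metis
  have fS: "f i \<in> S m" "f i < K" if "i < r m" for i
    using f S that by (auto simp: bij_betw_def)
  have f_eq: "f i = f j \<longleftrightarrow> i = j" if "i < r m" "j < r m" for i j
    using f that by (auto simp: bij_betw_def inj_on_def)
  define V where "V = mat (r m) (r m) (\<lambda>(i,j). U m $$ (i, f j))"
  have V: "V \<in> carrier_mat (r m) (r m)" by (simp add: V_def)
  have VU: "(V\<^sup>T * U m) $$ (i,k) = (if f i = k then 1 else 0)" if "i < r m" "k < K" for i k
  proof -
    have "(V\<^sup>T * U m) $$ (i,k) = (\<Sum>l<r m. U m $$ (l, f i) * U m $$ (l,k))"
      using that V U[OF m] by (subst mult_entry[of "V\<^sup>T" "r m" "r m" "U m" K]) (auto simp: V_def)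
    also have "\<dots> = ((U m)\<^sup>T * U m) $$ (f i,k)"
      using that fS U[OF m] by (subst mult_entry[of "(U m)\<^sup>T" K "r m" "U m" K]) auto
    finally show ?thesis using cols[OF m fS(2) that(2)] that fS by auto
  qed
  have "V\<^sup>T * V = 1\<^sub>m (r m)"
  proof (rule eq_matI)
    fix i j assume "i < dim_row (1\<^sub>m (r m) :: real mat)" "j < dim_col (1\<^sub>m (r m) :: real mat)"
    then have ij: "i < r m" "j < r m" by auto
    have "(V\<^sup>T * V) $$ (i,j) = (\<Sum>l<r m. V\<^sup>T $$ (i,l) * V $$ (l,j))"
      using ij V by (intro mult_entry) auto
    also have "\<dots> = (\<Sum>l<r m. V\<^sup>T $$ (i,l) * U m $$ (l,f j))" using ij by (simp add: V_def)
    also have "\<dots> = (V\<^sup>T * U m) $$ (i, f j)"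
      using ij V U[OF m] fS by (subst mult_entry[of "V\<^sup>T" "r m" "r m" "U m" K]) auto
    finally show "(V\<^sup>T * V) $$ (i,j) = 1\<^sub>m (r m) $$ (i,j)"
      using VU[OF ij(1) fS(2)[OF ij(2)]] f_eq ij by simp
  qed (use V in auto)
  then have "real_orthogonal (r m) V" using V unfolding real_orthogonal_def by simp
  moreover have "off_diag_sq (r m) (V\<^sup>T * ((U m * (U n)\<^sup>T) * (U m * (U n)\<^sup>T)\<^sup>T) * V) = 0" if n: "n < M" for n
    unfolding off_diag_sq_eq_0_iff
  proof (intro allI impI)
    fix i j assume ij: "i < r m" "j < r m" "i \<noteq> j"
    then show "(V\<^sup>T * ((U m * (U n)\<^sup>T) * (U m * (U n)\<^sup>T)\<^sup>T) * V) $$ (i,j) = 0"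
      unfolding conj_gram_entry[OF V U[OF m] U[OF n] cols[OF n] ij(1,2), simplified]
      by (intro sum.neutral ballI) (auto simp: VU f_eq)
  qed
  ultimately show thesis using that by simp
qed

text \<open>
  A row of \<open>D\<^sup>T U\<close> is, in the coordinates given by the modes, an eigenvector of the projection onto the
  modes in \<open>S n\<close>, so its nonzero entries all lie inside or all lie outside \<open>S n\<close>.
\<close>

lemma minimizer_rows_one_class:
  fixes U :: "nat \<Rightarrow> real mat"
  assumes U: "\<And>n. n < M \<Longrightarrow> U n \<in> carrier_mat (r n) K"
    and cols: "\<And>n j k. n < M \<Longrightarrow> j < K \<Longrightarrow> k < K \<Longrightarrow>
      ((U n)\<^sup>T * U n) $$ (j,k) = (if j = k \<and> k \<in> S n then 1 else 0)"
    and supp: "\<And>i k. i < r m \<Longrightarrow> k < K \<Longrightarrow> U m $$ (i,k) \<noteq> 0 \<Longrightarrow> k \<in> S m"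
    and card: "card (S m) = r m" and S: "S m \<subseteq> {..<K}" and m: "m < M"
    and min: "is_arg_min (\<lambda>V. \<Sum>n<M. off_diag_sq (r m)
        (V\<^sup>T * ((U m * (U n)\<^sup>T) * (U m * (U n)\<^sup>T)\<^sup>T) * V)) (real_orthogonal (r m)) D"
    and n: "n < M" and ik: "i < r m" "k < K" "k' < K"
    and nz: "(D\<^sup>T * U m) $$ (i,k) \<noteq> 0" "(D\<^sup>T * U m) $$ (i,k') \<noteq> 0"
  shows "k \<in> S n \<longleftrightarrow> k' \<in> S n"
proof -
  let ?obj = "\<lambda>V. \<Sum>n<M. off_diag_sq (r m) (V\<^sup>T * ((U m * (U n)\<^sup>T) * (U m * (U n)\<^sup>T)\<^sup>T) * V)"
  have "real_orthogonal (r m) D" using min by (simp add: is_arg_min_def)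
  note D = real_orthogonalD[OF this]
  obtain V where V: "real_orthogonal (r m) V" "?obj V = 0"
    using joint_diagonalizer_exists[of M U r K S m, OF U cols card S m] by blast
  \<comment> \<open>Some orthogonal matrix attains the value \<open>0\<close> and all summands are
    nonnegative, so every summand vanishes at the minimizer.\<close>
  have "\<forall>Y. real_orthogonal (r m) Y \<longrightarrow> \<not> ?obj Y < ?obj D" using min unfolding is_arg_min_def by blast
  then have "\<not> ?obj V < ?obj D" using V(1) by blast
  then have "\<not> 0 < ?obj D" unfolding V(2) .
  moreover have "?obj D \<ge> 0" by (intro sum_nonneg off_diag_sq_nonneg)
  ultimately have "?obj D = 0" by simp
  then have "off_diag_sq (r m) (D\<^sup>T * ((U m * (U n)\<^sup>T) * (U m * (U n)\<^sup>T)\<^sup>T) * D) = 0"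
    using n by (subst (asm) sum_nonneg_eq_0_iff) (auto intro: off_diag_sq_nonneg)
  then have off: "(D\<^sup>T * ((U m * (U n)\<^sup>T) * (U m * (U n)\<^sup>T)\<^sup>T) * D) $$ (i,j) = 0" if "j < r m" "i \<noteq> j" for j
    using ik that unfolding off_diag_sq_eq_0_iff by blast
  define E where "E = D\<^sup>T * U m"
  have E: "E \<in> carrier_mat (r m) K" unfolding E_def using D U[OF m] by simp
  \<comment> \<open>Row \<open>i\<close> of \<open>E * \<Pi> * E\<^sup>T\<close>, where \<Pi> is the
    coordinate projection onto \<open>S n\<close>. Only the diagonal entry \<open>b i\<close> can be
    nonzero; it turns out to be the eigenvalue of \<Pi> on row \<open>i\<close> of
    \<open>E\<close>.\<close>
  define b where "b = (\<lambda>j. \<Sum>l<K. E $$ (i,l) * (if l \<in> S n then E $$ (j,l) else 0))"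
  have b: "b j = 0" if "j < r m" "j \<noteq> i" for j
    using off[of j] conj_gram_entry[OF D(1) U[OF m] U[OF n] cols[OF n] ik(1) that(1)] that
    unfolding b_def E_def by simp
  have Et: "E\<^sup>T = (U m)\<^sup>T * D" unfolding E_def using D U[OF m] by (subst transpose_mult[of _ "r m" "r m"]) auto
  have "E\<^sup>T * E = (U m)\<^sup>T * ((D * D\<^sup>T) * U m)" unfolding Et unfolding E_def
    using D(1) U[OF m] by (simp add: assoc_mult_mat[of _ K "r m" _ "r m" _ K]
        assoc_mult_mat[of _ "r m" "r m" _ "r m" _ K])
  then have EtE: "E\<^sup>T * E = (U m)\<^sup>T * U m" using D(3) U[OF m] by simp
  have gram: "(\<Sum>j<r m. E $$ (j,l) * E $$ (j,k)) = (if l = k \<and> k \<in> S m then 1 else 0)"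
    if "l < K" "k < K" for l k
    using cols[OF m that] E that unfolding EtE[symmetric]
    by (subst (asm) mult_entry[of "E\<^sup>T" K "r m" E K]) auto
  have supE: "k \<in> S m" if k: "k < K" "E $$ (i,k) \<noteq> 0" for k
  proof -
    have "E $$ (i,k) = (\<Sum>l<r m. D\<^sup>T $$ (i,l) * U m $$ (l,k))"
      unfolding E_def using D U[OF m] ik k by (intro mult_entry) auto
    with k obtain l where "l < r m" "D\<^sup>T $$ (i,l) * U m $$ (l,k) \<noteq> 0"
      by (metis (no_types, lifting) lessThan_iff sum.neutral)
    then show ?thesis using supp k by auto
  qed
  \<comment> \<open>Row \<open>i\<close> of \<open>E * \<Pi> * E\<^sup>T * E\<close> is computed in
    two ways. Through \<open>b\<close> its entry \<open>k\<close> is \<open>b i\<close> times the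
    entry of \<open>E\<close>. On the other hand \<open>E\<^sup>T * E\<close> is the coordinate
    projection onto \<open>S m\<close>, and \<open>S m\<close> contains \<open>k\<close>, so \<Pi>
    alone decides whether the entry of \<open>E\<close> is kept or removed. Cancelling the nonzero
    entry leaves \<open>1\<close> or \<open>0\<close>.\<close>
  have key: "b i = (if k \<in> S n then 1 else 0)" if k: "k < K" "E $$ (i,k) \<noteq> 0" for k
  proof -
    have "b i * E $$ (i,k) = (\<Sum>j<r m. if j = i then b i * E $$ (i,k) else 0)" using ik by simp
    also have "\<dots> = (\<Sum>j<r m. b j * E $$ (j,k))" using b by (intro sum.cong) auto
    also have "\<dots> = (\<Sum>j<r m. \<Sum>l<K. (if l \<in> S n then E $$ (i,l) else 0) * (E $$ (j,l) * E $$ (j,k)))"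
      unfolding b_def sum_distrib_right by (intro sum.cong) auto
    also have "\<dots> = (\<Sum>l<K. \<Sum>j<r m. (if l \<in> S n then E $$ (i,l) else 0) * (E $$ (j,l) * E $$ (j,k)))"
      by (rule sum.swap)
    also have "\<dots> = (\<Sum>l<K. (if l \<in> S n then E $$ (i,l) else 0) * (if l = k \<and> k \<in> S m then 1 else 0))"
      unfolding sum_distrib_left[symmetric] using gram k by (intro sum.cong) auto
    also have "\<dots> = (\<Sum>l<K. if l = k then (if k \<in> S n then E $$ (i,k) else 0) else 0)"
      using supE[OF k] by (intro sum.cong) auto
    also have "\<dots> = (if k \<in> S n then E $$ (i,k) else 0)" using k by simp
    finally show ?thesis using k by (auto split: if_splits)
  qed
  have "b i = (if k \<in> S n then 1 else 0)" "b i = (if k' \<in> S n then 1 else 0)"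
    using key[of k] key[of k'] nz[folded E_def] ik by simp_all
  then show ?thesis by (auto split: if_splits)
qed

section \<open>Factoring a diagonal block and assembling the patches\<close>

text \<open>Orthonormality makes \<open>H\<^sup>T * H\<close> the diagonal matrix of the positive
  eigenvalues. It is invertible, so \<open>mat_inverse\<close> returns a value and
  \<open>left_pinv H\<close> is a genuine left inverse.\<close>

lemma scaled_eigenvectors:
  fixes B :: "real mat"
  assumes eig: "eigendecomposition B \<gamma> h" and n: "n = dim_row B" and r: "r = mat_rank B"
    and H_def: "H = mat_of_cols n (map (\<lambda>i. sqrt (\<gamma> i) \<cdot>\<^sub>v h i) [0..<r])"
  shows "H \<in> carrier_mat n r" "left_pinv H \<in> carrier_mat r n" "left_pinv H * H = 1\<^sub>m r" "B = H * H\<^sup>T"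
proof -
  have \<gamma>: "0 < \<gamma> i" "h i \<in> carrier_vec n" if "i < r" for i
    using eig that unfolding eigendecomposition_def n r by auto
  have hh: "h i \<bullet> h j = (if i = j then 1 else 0)" if "i < r" "j < r" for i j
    using eig that unfolding eigendecomposition_def r by auto
  have B: "B = sum_outer n r \<gamma> h" using eig by (simp only: eigendecomposition_def n r)
  show H: "H \<in> carrier_mat n r" unfolding H_def carrier_mat_def by simp
  have He: "H $$ (a,i) = sqrt (\<gamma> i) * h i $ a" if "a < n" "i < r" for a i
    unfolding H_def using that \<gamma>[OF that(2)] by (simp add: mat_of_cols_index)
  show "B = H * H\<^sup>T"
  proof (rule eq_matI)
    fix a b assume "a < dim_row (H * H\<^sup>T)" "b < dim_col (H * H\<^sup>T)"
    then have ab: "a < n" "b < n" using H by auto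
    have "(H * H\<^sup>T) $$ (a,b) = (\<Sum>k<r. H $$ (a,k) * H $$ (b,k))"
      using ab H by (subst mult_entry[of H n r "H\<^sup>T" n]) auto
    also have "\<dots> = (\<Sum>k<r. \<gamma> k * (h k $ a * h k $ b))"
    proof (intro sum.cong refl)
      fix k assume "k \<in> {..<r}"
      then have k: "k < r" by simp
      then have "sqrt (\<gamma> k) * sqrt (\<gamma> k) = \<gamma> k" using \<gamma>(1)[OF k] by simp
      then show "H $$ (a,k) * H $$ (b,k) = \<gamma> k * (h k $ a * h k $ b)"
        using k ab by (simp add: He algebra_simps)
    qed
    finally show "B $$ (a,b) = (H * H\<^sup>T) $$ (a,b)" unfolding B using ab by (simp add: sum_outer_def)
  qed (use H B in \<open>auto simp: sum_outer_def\<close>)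
  define \<Gamma> where "\<Gamma> = H\<^sup>T * H"
  have \<Gamma>: "\<Gamma> \<in> carrier_mat r r" unfolding \<Gamma>_def using H by simp
  have \<Gamma>e: "\<Gamma> $$ (i,j) = (if i = j then \<gamma> i else 0)" if ij: "i < r" "j < r" for i j
  proof -
    have "\<Gamma> $$ (i,j) = (\<Sum>a<n. H $$ (a,i) * H $$ (a,j))"
      unfolding \<Gamma>_def using ij H by (subst mult_entry[of "H\<^sup>T" r n H r]) auto
    also have "\<dots> = (sqrt (\<gamma> i) * sqrt (\<gamma> j)) * (\<Sum>a<n. h i $ a * h j $ a)"
      unfolding sum_distrib_left using ij by (intro sum.cong refl) (simp add: He)
    also have "(\<Sum>a<n. h i $ a * h j $ a) = h i \<bullet> h j"
      using \<gamma>(2)[OF ij(2)] by (simp add: scalar_prod_def lessThan_atLeast0)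
    finally show ?thesis using hh[OF ij] \<gamma>(1)[OF ij(1)] by auto
  qed
  have "\<gamma> i \<noteq> 0" if "i < r" for i using \<gamma>(1)[OF that] by simp
  then have "prod_list (diag_mat \<Gamma>) \<noteq> 0"
    unfolding prod_list_zero_iff using \<Gamma> by (auto simp: diag_mat_def \<Gamma>e)
  moreover have "det \<Gamma> = prod_list (diag_mat \<Gamma>)"
    by (rule det_lower_triangular[OF _ \<Gamma>]) (simp add: \<Gamma>e)
  ultimately have "\<Gamma> \<in> Units (ring_mat TYPE(real) r ())" using det_non_zero_imp_unit[OF \<Gamma>] by simp
  then obtain C where C: "mat_inverse \<Gamma> = Some C" using mat_inverse(1)[OF \<Gamma>] by fastforce
  note inv = mat_inverse(2)[OF \<Gamma> C]
  have lp: "left_pinv H = C * H\<^sup>T" unfolding left_pinv_def \<Gamma>_def[symmetric] C by simp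
  show "left_pinv H \<in> carrier_mat r n" unfolding lp using inv H by auto
  show "left_pinv H * H = 1\<^sub>m r" unfolding lp
    using inv H assoc_mult_mat[of C r r "H\<^sup>T" n H r] by (simp add: \<Gamma>_def)
qed

text \<open>Stacking the \<open>U m\<close> into \<open>X\<close> gives
  \<open>\<Lambda> = X * X\<^sup>T\<close>, so the Cholesky step factors
  \<open>E * E\<^sup>T\<close> with \<open>E = B\<^sup>T * X\<close> and \<open>B\<close> the block
  diagonal matrix of the \<open>D m\<close>. As the \<open>D m\<close> are orthogonal,
  \<open>B * E = X\<close>, and \<open>Q * L = E * W\<close> becomes
  \<open>B * (Q * L) = X * W\<close>.\<close>

lemma block_rotation:
  fixes U D :: "nat \<Rightarrow> real mat" and r :: "nat \<Rightarrow> nat"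
  assumes U: "\<And>n. n < M \<Longrightarrow> U n \<in> carrier_mat (r n) K"
    and cols: "\<And>n j k. n < M \<Longrightarrow> j < K \<Longrightarrow> k < K \<Longrightarrow>
      ((U n)\<^sup>T * U n) $$ (j,k) = (if j = k \<and> k \<in> S n then 1 else 0)"
    and supp: "\<And>n i k. n < M \<Longrightarrow> i < r n \<Longrightarrow> k < K \<Longrightarrow> U n $$ (i,k) \<noteq> 0 \<Longrightarrow> k \<in> S n"
    and card: "\<And>n. n < M \<Longrightarrow> card (S n) = r n" and S: "\<And>n. n < M \<Longrightarrow> S n \<subseteq> {..<K}"
    and min: "\<And>m. m < M \<Longrightarrow> is_arg_min (\<lambda>V. \<Sum>n<M. off_diag_sq (r m)
        (V\<^sup>T * ((U m * (U n)\<^sup>T) * (U m * (U n)\<^sup>T)\<^sup>T) * V)) (real_orthogonal (r m)) (D m)"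
    and Lam: "\<Lambda> \<in> carrier_mat (sum r {..<M}) (sum r {..<M})"
    and Lam_entry: "\<And>m n i j. m < M \<Longrightarrow> n < M \<Longrightarrow> i < r m \<Longrightarrow> j < r n \<Longrightarrow>
        \<Lambda> $$ (sum r {..<m} + i, sum r {..<n} + j) = (U m * (U n)\<^sup>T) $$ (i,j)"
    and chol: "pivoted_cholesky ((diag_block_mat (map D [0..<M]))\<^sup>T * \<Lambda> * diag_block_mat (map D [0..<M])) K Q L"
  obtains W where "W \<in> carrier_mat K K" "W * W\<^sup>T = 1\<^sub>m K"
    "\<And>j j' k m. j < K \<Longrightarrow> j' < K \<Longrightarrow> k < K \<Longrightarrow> W $$ (j,k) \<noteq> 0 \<Longrightarrow> W $$ (j',k) \<noteq> 0 \<Longrightarrow> m < M \<Longrightarrow>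
      j \<in> S m \<longleftrightarrow> j' \<in> S m"
    "Q \<in> carrier_mat (sum r {..<M}) (sum r {..<M})" "L \<in> carrier_mat (sum r {..<M}) K"
    "\<And>m i k. m < M \<Longrightarrow> i < r m \<Longrightarrow> k < K \<Longrightarrow>
      (diag_block_mat (map D [0..<M]) * (Q * L)) $$ (sum r {..<m} + i, k) = (U m * W) $$ (i,k)"
proof -
  define s where "s = sum r {..<M}"
  define B where "B = diag_block_mat (map D [0..<M])"
  have D: "D m \<in> carrier_mat (r m) (r m)" "(D m)\<^sup>T * D m = 1\<^sub>m (r m)" "D m * (D m)\<^sup>T = 1\<^sub>m (r m)" if "m < M" for m
    using min[OF that] real_orthogonalD[of "r m" "D m"] by (auto simp: is_arg_min_def)
  have B: "B \<in> carrier_mat s s" unfolding B_def s_def by (rule diag_block_mat_entry(1)) (rule D)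
  obtain f where f: "\<And>m i. m < M \<Longrightarrow> i < r m \<Longrightarrow> f (sum r {..<m} + i) = (\<lambda>k. U m $$ (i,k))"
    using block_function_exists[of M r "\<lambda>m i k. U m $$ (i,k)"] by blast
  define X where "X = mat s K (\<lambda>(p,k). f p k)"
  have X: "X \<in> carrier_mat s K" by (simp add: X_def)
  have Xe: "X $$ (sum r {..<m} + i, k) = U m $$ (i,k)" if "m < M" "i < r m" "k < K" for m i k
    using that block_pos_less[of m M i r] f[OF that(1,2)] by (simp add: X_def s_def)
  have Lam_eq: "\<Lambda> = X * X\<^sup>T"
  proof (rule eq_matI)
    fix p q assume "p < dim_row (X * X\<^sup>T)" "q < dim_col (X * X\<^sup>T)"
    then have pq: "p < s" "q < s" using X by auto
    obtain m i where p: "m < M" "i < r m" "p = sum r {..<m} + i" using pq(1) unfolding s_def by (rule block_posE)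
    obtain n j where q: "n < M" "j < r n" "q = sum r {..<n} + j" using pq(2) unfolding s_def by (rule block_posE)
    have "(X * X\<^sup>T) $$ (p,q) = (\<Sum>k<K. X $$ (p,k) * X\<^sup>T $$ (k,q))"
      using X pq by (intro mult_entry) auto
    also have "\<dots> = (\<Sum>k<K. U m $$ (i,k) * U n $$ (j,k))"
      using X pq Xe p q by (intro sum.cong refl) simp
    also have "\<dots> = (\<Sum>k<K. U m $$ (i,k) * (U n)\<^sup>T $$ (k,j))"
      using U[OF q(1)] q by (intro sum.cong refl) simp
    also have "\<dots> = (U m * (U n)\<^sup>T) $$ (i,j)"
      using U[OF q(1)] U[OF p(1)] p q by (intro mult_entry[symmetric]) auto
    finally show "\<Lambda> $$ (p,q) = (X * X\<^sup>T) $$ (p,q)" using Lam_entry p q by simp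
  qed (use X Lam s_def in auto)
  define E where "E = B\<^sup>T * X"
  have E: "E \<in> carrier_mat s K" unfolding E_def using B X by simp
  have Ee: "E $$ (sum r {..<m} + i, k) = ((D m)\<^sup>T * U m) $$ (i,k)" if m: "m < M" "i < r m" "k < K" for m i k
  proof -
    have "E $$ (sum r {..<m} + i, k) = (\<Sum>l<r m. D m $$ (l,i) * X $$ (sum r {..<m} + l, k))"
      unfolding E_def B_def using m X D by (intro diag_block_mat_transpose_mult_entry) (auto simp: s_def)
    also have "\<dots> = (\<Sum>l<r m. (D m)\<^sup>T $$ (i,l) * U m $$ (l,k))"
      using m D(1)[OF m(1)] Xe by (intro sum.cong refl) simp
    also have "\<dots> = ((D m)\<^sup>T * U m) $$ (i,k)"
      using m D(1)[OF m(1)] U[OF m(1)] by (intro mult_entry[symmetric]) auto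
    finally show ?thesis .
  qed
  have Et: "E\<^sup>T = X\<^sup>T * B" unfolding E_def using B X by (subst transpose_mult[of _ s s]) auto
  have "B\<^sup>T * \<Lambda> * B = E * E\<^sup>T" unfolding Et Lam_eq unfolding E_def using B X
    by (simp add: assoc_mult_mat[of _ s s _ s _ s] assoc_mult_mat[of _ s s _ K _ s] assoc_mult_mat[of _ s K _ s _ s])
  with chol have chol': "pivoted_cholesky (E * E\<^sup>T) K Q L" by (simp add: B_def)
  \<comment> \<open>The class of a mode is the set of patches whose \<open>S m\<close> contains it.
    By minimality of the \<open>D m\<close>, each row of \<open>E\<close> meets one class
    only.\<close>
  define cl where "cl = (\<lambda>k. {m. m < M \<and> k \<in> S m})"
  have EtE: "(E\<^sup>T * E) $$ (j,k) = 0" if jk: "j < K" "k < K" "j \<noteq> k" for j k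
  proof -
    have "(E\<^sup>T * E) $$ (j,k) = (\<Sum>p<s. E\<^sup>T $$ (j,p) * E $$ (p,k))"
      using E jk by (intro mult_entry) auto
    also have "\<dots> = (\<Sum>p<s. E $$ (p,j) * E $$ (p,k))"
      using E jk by (intro sum.cong refl) simp
    also have "\<dots> = (\<Sum>m<M. \<Sum>i<r m. E $$ (sum r {..<m} + i, j) * E $$ (sum r {..<m} + i, k))"
      unfolding s_def by (rule sum_blocks)
    also have "\<dots> = 0"
    proof (rule sum.neutral, rule ballI)
      fix m assume "m \<in> {..<M}"
      then have m: "m < M" by simp
      \<comment> \<open>The block of \<open>E\<close> that belongs to patch \<open>m\<close>. Its
        column products are those of \<open>U m\<close> because \<open>D m\<close> is
        orthogonal.\<close>
      define F where "F = (D m)\<^sup>T * U m"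
      have F: "F \<in> carrier_mat (r m) K" unfolding F_def using D(1)[OF m] U[OF m] by simp
      have "F\<^sup>T = (U m)\<^sup>T * D m" unfolding F_def using D(1)[OF m] U[OF m] by (subst transpose_mult[of _ "r m" "r m"]) auto
      then have "F\<^sup>T * F = (U m)\<^sup>T * ((D m * (D m)\<^sup>T) * U m)" unfolding F_def
        using D(1)[OF m] U[OF m] by (simp add: assoc_mult_mat[of _ K "r m" _ "r m" _ K]
            assoc_mult_mat[of _ "r m" "r m" _ "r m" _ K])
      then have FF: "F\<^sup>T * F = (U m)\<^sup>T * U m" using D(3)[OF m] U[OF m] by simp
      have "(\<Sum>i<r m. E $$ (sum r {..<m} + i, j) * E $$ (sum r {..<m} + i, k)) = (\<Sum>i<r m. F\<^sup>T $$ (j,i) * F $$ (i,k))"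
        using F jk m by (intro sum.cong refl) (simp add: Ee F_def[symmetric])
      also have "\<dots> = (F\<^sup>T * F) $$ (j,k)" using F jk by (intro mult_entry[symmetric]) auto
      finally show "(\<Sum>i<r m. E $$ (sum r {..<m} + i, j) * E $$ (sum r {..<m} + i, k)) = 0"
        unfolding FF using cols[OF m jk(1,2)] jk(3) by simp
    qed
    finally show ?thesis .
  qed
  have clE: "cl j = cl k" if p: "p < s" "j < K" "k < K" "E $$ (p,j) \<noteq> 0" "E $$ (p,k) \<noteq> 0" for p j k
  proof -
    obtain m i where mi: "m < M" "i < r m" "p = sum r {..<m} + i" using p(1) unfolding s_def by (rule block_posE)
    have nz: "((D m)\<^sup>T * U m) $$ (i,j) \<noteq> 0" "((D m)\<^sup>T * U m) $$ (i,k) \<noteq> 0"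
      using p(4,5) Ee[OF mi(1,2)] p(2,3) mi(3) by auto
    have "j \<in> S n \<longleftrightarrow> k \<in> S n" if n: "n < M" for n
      by (rule minimizer_rows_one_class[where M = M and U = U and r = r and K = K and S = S and m = m and D = "D m" and i = i])
        (fact U cols supp[OF mi(1)] card[OF mi(1)] S[OF mi(1)] mi(1) min[OF mi(1)] n mi(2) p(2) p(3) nz)+
    then show ?thesis unfolding cl_def by blast
  qed
  obtain W where W: "W \<in> carrier_mat K K" "W * W\<^sup>T = 1\<^sub>m K" "Q * L = E * W"
    and clW: "\<And>j j' k. j < K \<Longrightarrow> j' < K \<Longrightarrow> k < K \<Longrightarrow> W $$ (j,k) \<noteq> 0 \<Longrightarrow> W $$ (j',k) \<noteq> 0 \<Longrightarrow> cl j = cl j'"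
    and QL: "Q \<in> carrier_mat s s" "L \<in> carrier_mat s K"
    by (rule pivoted_cholesky_rotation[where cl = cl, OF E chol'])
      (erule (2) EtE, erule (4) clE, erule that, assumption, assumption, blast, assumption, assumption)
  have out: "(B * (Q * L)) $$ (sum r {..<m} + i, k) = (U m * W) $$ (i,k)" if m: "m < M" "i < r m" "k < K" for m i k
  proof -
    have "(B * E) $$ (sum r {..<m} + i, k) = U m $$ (i,k)" if k: "k < K" for k
    proof -
      have "(B * E) $$ (sum r {..<m} + i, k) = (\<Sum>l<r m. D m $$ (i,l) * E $$ (sum r {..<m} + l, k))"
        unfolding B_def using m k E D by (intro diag_block_mat_mult_entry) (auto simp: s_def)
      also have "\<dots> = (\<Sum>l<r m. D m $$ (i,l) * ((D m)\<^sup>T * U m) $$ (l,k))"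
        using m k by (intro sum.cong refl) (simp add: Ee)
      also have "\<dots> = (D m * ((D m)\<^sup>T * U m)) $$ (i,k)"
        using m k D(1)[OF m(1)] U[OF m(1)] by (intro mult_entry[symmetric]) auto
      also have "D m * ((D m)\<^sup>T * U m) = (D m * (D m)\<^sup>T) * U m"
        using D(1)[OF m(1)] U[OF m(1)] by (intro assoc_mult_mat[symmetric]) auto
      finally show ?thesis using D(3)[OF m(1)] U[OF m(1)] by simp
    qed
    note BE = this
    have p: "sum r {..<m} + i < s" unfolding s_def by (rule block_pos_less[where s = r, OF m(1,2)])
    have "B * (Q * L) = (B * E) * W" unfolding W(3) using B E W(1) by (intro assoc_mult_mat[symmetric]) auto
    then have "(B * (Q * L)) $$ (sum r {..<m} + i, k) = (\<Sum>l<K. (B * E) $$ (sum r {..<m} + i, l) * W $$ (l,k))"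
      using B E W(1) m p by (simp only:) (intro mult_entry, auto)
    also have "\<dots> = (\<Sum>l<K. U m $$ (i,l) * W $$ (l,k))" by (intro sum.cong refl) (simp add: BE)
    also have "\<dots> = (U m * W) $$ (i,k)" using U[OF m(1)] W(1) m by (intro mult_entry[symmetric]) auto
    finally show ?thesis .
  qed
  show thesis
  proof (rule that[of W])
    show "j \<in> S m \<longleftrightarrow> j' \<in> S m"
      if "j < K" "j' < K" "k < K" "W $$ (j,k) \<noteq> 0" "W $$ (j',k) \<noteq> 0" "m < M" for j j' k m
      using clW[OF that(1-5)] that(6) unfolding cl_def by blast
  qed (use W QL out in \<open>simp_all add: s_def B_def\<close>)
qed

subsection \<open>Patches and modes\<close>

lemma pick_image:
  assumes "finite P"
  shows "pick P ` {..<card P} = P"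
proof (intro equalityI subsetI)
  fix x assume x: "x \<in> P"
  \<comment> \<open>The number of elements of \<open>P\<close> below \<open>x\<close> is the index
    at which \<open>pick P\<close> returns \<open>x\<close>.\<close>
  have "card {a\<in>P. a < x} < card P" by (rule psubset_card_mono[OF assms]) (use x in auto)
  then show "x \<in> pick P ` {..<card P}"
    by (intro image_eqI[of x _ "card {a\<in>P. a < x}"] pick_card_in_set[OF x, symmetric]) simp
next
  fix x assume "x \<in> pick P ` {..<card P}"
  then obtain i where "i < card P" "x = pick P i" by auto
  then show "x \<in> P" by (simp only: pick_in_set_le)
qed

lemma pickE:
  assumes "finite P" "x \<in> P"
  obtains i where "i < card P" "x = pick P i"
proof -
  have "x \<in> pick P ` {..<card P}" unfolding pick_image[OF assms(1)] by (rule assms(2))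
  then show thesis using that by blast
qed

lemma pick_atLeastLessThan:
  assumes "i < b - a"
  shows "pick {a..<b} i = a + i"
proof -
  have "{x \<in> {a..<b}. x < a + i} = {a..<a + i}" using assms by auto
  then show ?thesis using pick_card_in_set[of "a + i" "{a..<b}"] assms by simp
qed

lemma block_range_eq: "block_range s m = {sum s {..<m}..<sum s {..<m} + s m}"
  unfolding block_range_def by simp

lemma card_block_range [simp]: "card (block_range s m) = s m"
  by (simp add: block_range_eq)

lemma pick_block_range: "i < s m \<Longrightarrow> pick (block_range s m) i = sum s {..<m} + i"
  unfolding block_range_eq by (rule pick_atLeastLessThan) simp

lemma submatrix_block_range:
  assumes "X \<in> carrier_mat (sum s {..<M}) (sum s {..<M})" "m < M" "n < M" "i < s m" "j < s n"
  shows "submatrix X (block_range s m) (block_range s n) $$ (i,j) = X $$ (sum s {..<m} + i, sum s {..<n} + j)"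
proof -
  have "{p. p < sum s {..<M} \<and> p \<in> block_range s l} = block_range s l" if "l < M" for l
    using block_pos_le[where s = s, OF that] by (auto simp: block_range_eq)
  then show ?thesis using assms by (subst submatrix_index) (auto simp: pick_block_range)
qed

lemma nonzero_on_iff:
  assumes "finite P"
  shows "nonzero_on v P \<longleftrightarrow> (\<exists>x\<in>P. v $ x \<noteq> 0)"
proof -
  have "nonzero_on v P \<longleftrightarrow> (\<exists>i<card P. v $ pick P i \<noteq> 0)"
    unfolding nonzero_on_def vec_restrict_def by (auto simp: vec_eq_iff)
  also have "\<dots> \<longleftrightarrow> (\<exists>x\<in>pick P ` {..<card P}. v $ x \<noteq> 0)" by blast
  finally show ?thesis unfolding pick_image[OF assms] .
qed

section \<open>Linear independence of the modes on a patch\<close>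

text \<open>Injectivity turns coefficients indexed by \<open>S\<close> into coefficients of the
  vectors themselves, via \<open>the_inv_into\<close>, so a nontrivial relation of the family is a
  linear dependence of its image.\<close>

lemma lin_indpt_familyD:
  assumes lin: "lin_indpt_family n S f" and finS: "finite S"
    and f: "\<And>k. k \<in> S \<Longrightarrow> f k \<in> carrier_vec n"
    and 0: "\<And>i. i < n \<Longrightarrow> (\<Sum>k\<in>S. c k * f k $ i) = 0" and k: "k \<in> S"
  shows "c k = 0"
proof (rule ccontr)
  assume ck: "c k \<noteq> 0"
  interpret vec_space "TYPE(real)" n .
  have inj: "inj_on f S" and indpt: "lin_indpt (f ` S)" using lin unfolding lin_indpt_family_def by auto
  define a where "a = (\<lambda>v. c (the_inv_into S f v))"
  have a: "a (f l) = c l" if "l \<in> S" for l using the_inv_into_f_f[OF inj that] by (simp add: a_def)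
  have car: "f ` S \<subseteq> carrier_vec n" using f by auto
  have "lincomb a (f ` S) = 0\<^sub>v n"
  proof (rule eq_vecI)
    show "dim_vec (lincomb a (f ` S)) = dim_vec (0\<^sub>v n)" using lincomb_dim[OF _ car] finS by simp
    fix i assume "i < dim_vec (0\<^sub>v n :: real vec)"
    then have i: "i < n" by simp
    have "lincomb a (f ` S) $ i = (\<Sum>v\<in>f ` S. a v * v $ i)" by (rule lincomb_index[OF i car])
    also have "\<dots> = (\<Sum>k\<in>S. c k * f k $ i)" by (subst sum.reindex[OF inj]) (simp add: a)
    finally show "lincomb a (f ` S) $ i = 0\<^sub>v n $ i" using 0[OF i] i by simp
  qed
  then have "lin_dep (f ` S)" unfolding lin_dep_def
    using finS k ck a[OF k] by (intro exI[of _ "f ` S"] exI[of _ a] exI[of _ "f k"]) auto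
  with indpt show False by simp
qed

text \<open>The condition of \<open>regular_sparse\<close> on one patch, in coordinates. The
  relations run over all \<open>K\<close> modes since those that vanish on \<open>P\<close>
  contribute nothing; in this form the condition passes to unions of patches.\<close>

definition modes_independent_on :: "nat \<Rightarrow> (nat \<Rightarrow> real vec) \<Rightarrow> nat set \<Rightarrow> bool" where
  "modes_independent_on K g P \<longleftrightarrow> (\<forall>c. (\<forall>x\<in>P. (\<Sum>k<K. g k $ x * c k) = 0) \<longrightarrow>
     (\<forall>k<K. nonzero_on (g k) P \<longrightarrow> c k = 0))"

lemma modes_independent_onD:
  assumes "modes_independent_on K g P" "\<And>x. x \<in> P \<Longrightarrow> (\<Sum>k<K. g k $ x * c k) = 0"
    "k < K" "nonzero_on (g k) P"
  shows "c k = 0"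
  using assms unfolding modes_independent_on_def by blast

lemma lin_indpt_family_modes_independent_on:
  assumes fin: "finite P"
    and lin: "lin_indpt_family (card P) {k. k < K \<and> nonzero_on (g k) P} (\<lambda>k. vec_restrict (g k) P)"
  shows "modes_independent_on K g P"
  unfolding modes_independent_on_def
proof (intro allI impI)
  fix c k assume 0: "\<forall>x\<in>P. (\<Sum>k<K. g k $ x * c k) = 0" and k: "k < K" "nonzero_on (g k) P"
  let ?S = "{k. k < K \<and> nonzero_on (g k) P}"
  have "(\<Sum>k\<in>?S. c k * vec_restrict (g k) P $ i) = 0" if i: "i < card P" for i
  proof -
    have iP: "pick P i \<in> P" using i by (rule pick_in_set_le)
    have "(\<Sum>k\<in>?S. c k * vec_restrict (g k) P $ i) = (\<Sum>k\<in>?S. g k $ pick P i * c k)"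
      using i by (intro sum.cong refl) (simp add: vec_restrict_def)
    also have "\<dots> = (\<Sum>k<K. g k $ pick P i * c k)"
      using iP nonzero_on_iff[OF fin] by (intro sum.mono_neutral_left) auto
    finally show ?thesis using 0 iP by simp
  qed
  from lin_indpt_familyD[OF lin _ _ this] k show "c k = 0" by (simp add: vec_restrict_def)
qed

text \<open>A mode that is nonzero on \<open>P\<close> is nonzero on some \<open>F\<close> inside
  \<open>P\<close>, and a relation on \<open>P\<close> restricts to \<open>F\<close>. This carries
  independence from the fine partition to the coarse one.\<close>

lemma modes_independent_on_coarser:
  assumes "finite P" and fine: "\<And>x. x \<in> P \<Longrightarrow> \<exists>F. x \<in> F \<and> F \<subseteq> P \<and> modes_independent_on K g F"
  shows "modes_independent_on K g P"
  unfolding modes_independent_on_def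
proof (intro allI impI)
  fix c k assume 0: "\<forall>x\<in>P. (\<Sum>k<K. g k $ x * c k) = 0" and k: "k < K" "nonzero_on (g k) P"
  then obtain x where x: "x \<in> P" "g k $ x \<noteq> 0" using nonzero_on_iff[OF assms(1)] by blast
  obtain F where F: "x \<in> F" "F \<subseteq> P" "modes_independent_on K g F" using fine[OF x(1)] by blast
  have "nonzero_on (g k) F" using F x nonzero_on_iff[of F] finite_subset[OF F(2) assms(1)] by blast
  then show "c k = 0" using modes_independent_onD[OF F(3) _ k(1)] 0 F(2) by blast
qed

section \<open>The output modes as an orthogonal transformation of the sparse modes\<close>

definition modes_mat :: "nat \<Rightarrow> nat \<Rightarrow> (nat \<Rightarrow> real vec) \<Rightarrow> real mat" where
  "modes_mat N K g = mat N K (\<lambda>(x,k). g k $ x)"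

lemma modes_mat_carrier [simp]: "modes_mat N K g \<in> carrier_mat N K"
  by (simp add: modes_mat_def)

lemma modes_mat_mult_entry:
  assumes "modes_mat N K g' = modes_mat N K g * W" "W \<in> carrier_mat K K" "x < N" "k < K"
  shows "g' k $ x = (\<Sum>j<K. g j $ x * W $$ (j,k))"
proof -
  have "g' k $ x = modes_mat N K g' $$ (x,k)" using assms(3,4) by (simp add: modes_mat_def)
  also have "\<dots> = (\<Sum>j<K. modes_mat N K g $$ (x,j) * W $$ (j,k))"
    unfolding assms(1) using assms by (intro mult_entry) auto
  finally show ?thesis using assms(3,4) by (simp add: modes_mat_def)
qed

text \<open>On patch \<open>m\<close> the restricted modes are \<open>H m * U m\<close> and the
  blocks of \<Lambda> are \<open>U m * (U n)\<^sup>T\<close>, so the assembled rotation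
  \<open>W\<close> applies; multiplying back by \<open>H m\<close> gives the restricted modes times
  \<open>W\<close>. One \<open>W\<close> serves all patches, so the relation holds globally. That
  \<open>W\<close> mixes one class at a time bounds the supports from above, and independence
  excludes cancellation.\<close>

lemma ismd_rotation:
  assumes A: "A \<in> carrier_mat N N" and part: "partition_on {..<N} (set Ps)" and K: "K = mat_rank A"
    and A_eq: "A = sum_outer N K (\<lambda>_. 1) g"
    and indep: "\<And>P. P \<in> set Ps \<Longrightarrow> modes_independent_on K g P"
    and ismd: "ismd A Ps g'"
  obtains W where "W \<in> carrier_mat K K" "W * W\<^sup>T = 1\<^sub>m K" "modes_mat N K g' = modes_mat N K g * W"
    "\<And>j k. j < K \<Longrightarrow> k < K \<Longrightarrow> W $$ (j,k) \<noteq> 0 \<Longrightarrow> patch_support (set Ps) (g' k) = patch_support (set Ps) (g j)"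
    "\<And>k. k < K \<Longrightarrow> g' k \<in> carrier_vec N"
proof -
  define M where "M = length Ps"
  define c where "c = (\<lambda>m. card (Ps ! m))"
  define Ab where "Ab = (\<lambda>m n. submatrix A (Ps ! m) (Ps ! n))"
  define Km where "Km = (\<lambda>m. mat_rank (Ab m m))"
  \<comment> \<open>\<open>HH\<close> and \<open>LL\<close> take the eigenpairs as arguments,
    because these are fixed only after the existential quantifiers have been eliminated.\<close>
  define HH where "HH = (\<lambda>\<gamma> (h :: nat \<Rightarrow> nat \<Rightarrow> real vec) m. mat_of_cols (c m) (map (\<lambda>i. sqrt (\<gamma> m i) \<cdot>\<^sub>v h m i) [0..<Km m]))"
  define LL where "LL = (\<lambda>\<gamma> h m n. left_pinv (HH \<gamma> h m) * Ab m n * (left_pinv (HH \<gamma> h n))\<^sup>T)"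
  have "\<exists>\<gamma> h \<Lambda> D Q L.
      (\<forall>m<M. eigendecomposition (Ab m m) (\<gamma> m) (h m)) \<and>
      \<Lambda> \<in> carrier_mat (sum Km {..<M}) (sum Km {..<M}) \<and>
      (\<forall>m<M. \<forall>n<M. submatrix \<Lambda> (block_range Km m) (block_range Km n) = LL \<gamma> h m n) \<and>
      (\<forall>m<M. is_arg_min (\<lambda>V. \<Sum>n<M. off_diag_sq (Km m) (V\<^sup>T * (LL \<gamma> h m n * (LL \<gamma> h m n)\<^sup>T) * V))
           (real_orthogonal (Km m)) (D m)) \<and>
      pivoted_cholesky ((diag_block_mat (map D [0..<M]))\<^sup>T * \<Lambda> * diag_block_mat (map D [0..<M])) K Q L \<and>
      (\<forall>k<K. g' k \<in> carrier_vec (dim_row A) \<and>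
        (\<forall>m<M. vec_restrict (g' k) (Ps ! m) =
           vec_restrict (col (diag_block_mat (map (HH \<gamma> h) [0..<M]) * diag_block_mat (map D [0..<M]) * Q * L) k)
             (block_range c m)))"
    using ismd unfolding ismd_def Let_def K LL_def HH_def Km_def Ab_def c_def M_def .
  then obtain \<gamma> h \<Lambda> D Q L where
    eig: "\<And>m. m < M \<Longrightarrow> eigendecomposition (Ab m m) (\<gamma> m) (h m)" and
    Lam: "\<Lambda> \<in> carrier_mat (sum Km {..<M}) (sum Km {..<M})" and
    Lam_block: "\<And>m n. m < M \<Longrightarrow> n < M \<Longrightarrow> submatrix \<Lambda> (block_range Km m) (block_range Km n) = LL \<gamma> h m n" and
    min: "\<And>m. m < M \<Longrightarrow> is_arg_min (\<lambda>V. \<Sum>n<M. off_diag_sq (Km m) (V\<^sup>T * (LL \<gamma> h m n * (LL \<gamma> h m n)\<^sup>T) * V))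
           (real_orthogonal (Km m)) (D m)" and
    chol: "pivoted_cholesky ((diag_block_mat (map D [0..<M]))\<^sup>T * \<Lambda> * diag_block_mat (map D [0..<M])) K Q L" and
    g'_car: "\<And>k. k < K \<Longrightarrow> g' k \<in> carrier_vec (dim_row A)" and
    g'_restrict: "\<And>k m. k < K \<Longrightarrow> m < M \<Longrightarrow> vec_restrict (g' k) (Ps ! m) =
           vec_restrict (col (diag_block_mat (map (HH \<gamma> h) [0..<M]) * diag_block_mat (map D [0..<M]) * Q * L) k)
             (block_range c m)"
    by blast
  define H where "H = HH \<gamma> h"
  define G where "G = (\<lambda>m. mat (c m) K (\<lambda>(a,k). g k $ pick (Ps ! m) a))"
  define U where "U = (\<lambda>m. left_pinv (H m) * G m)"
  have patch: "Ps ! m \<subseteq> {..<N}" "finite (Ps ! m)" if "m < M" for m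
  proof -
    have "Ps ! m \<in> set Ps" using that by (simp add: M_def)
    then show "Ps ! m \<subseteq> {..<N}" using part unfolding partition_on_def by blast
    then show "finite (Ps ! m)" by (rule finite_subset) simp
  qed
  have G: "G m \<in> carrier_mat (c m) K" for m by (simp add: G_def)
  have Ab: "Ab m n = G m * (G n)\<^sup>T" if mn: "m < M" "n < M" for m n
  proof -
    have sel: "{i. i < N \<and> i \<in> Ps ! l} = Ps ! l" if "l < M" for l using patch(1)[OF that] by auto
    show ?thesis
    proof (rule eq_matI)
      fix a b assume "a < dim_row (G m * (G n)\<^sup>T)" "b < dim_col (G m * (G n)\<^sup>T)"
      then have ab: "a < c m" "b < c n" using G[of m] G[of n] by auto
      have in_N: "pick (Ps ! m) a < N" "pick (Ps ! n) b < N"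
        using pick_in_set_le[of a "Ps ! m"] pick_in_set_le[of b "Ps ! n"] ab patch(1) mn by (auto simp: c_def)
      have "Ab m n $$ (a,b) = A $$ (pick (Ps ! m) a, pick (Ps ! n) b)"
        unfolding Ab_def using A ab mn by (intro submatrix_index) (auto simp: sel c_def)
      also have "\<dots> = (\<Sum>k<K. G m $$ (a,k) * (G n)\<^sup>T $$ (k,b))"
        unfolding A_eq using in_N ab by (simp add: sum_outer_def G_def)
      also have "\<dots> = (G m * (G n)\<^sup>T) $$ (a,b)"
        using G[of m] G[of n] ab by (intro mult_entry[symmetric]) auto
      finally show "Ab m n $$ (a,b) = (G m * (G n)\<^sup>T) $$ (a,b)" .
    qed (use A mn in \<open>auto simp: Ab_def dim_submatrix sel c_def G_def\<close>)
  qed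
  have H: "H m \<in> carrier_mat (c m) (Km m)" "left_pinv (H m) \<in> carrier_mat (Km m) (c m)"
    "left_pinv (H m) * H m = 1\<^sub>m (Km m)" "Ab m m = H m * (H m)\<^sup>T" if m: "m < M" for m
  proof -
    have d: "c m = dim_row (Ab m m)" using Ab[OF m m] G[of m] by simp
    show "H m \<in> carrier_mat (c m) (Km m)" "left_pinv (H m) \<in> carrier_mat (Km m) (c m)"
      "left_pinv (H m) * H m = 1\<^sub>m (Km m)" "Ab m m = H m * (H m)\<^sup>T"
      using scaled_eigenvectors[OF eig[OF m] d, of "Km m" "H m"] by (simp_all add: Km_def H_def HH_def)
  qed
  have U_eq: "U m = left_pinv (H m) * G m" for m by (simp add: U_def)
  have U: "U m \<in> carrier_mat (Km m) K" if "m < M" for m unfolding U_eq using H(2)[OF that] G by simp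
  have gram: "G m * (G m)\<^sup>T = H m * (H m)\<^sup>T" if "m < M" for m using Ab[OF that that] H(4)[OF that] by simp
  have HU: "H m * U m = G m" if m: "m < M" for m
    unfolding U_eq by (rule gram_eq_left_inverse(2)[OF G H(1-3)[OF m] gram[OF m]])
  have nz: "nz_cols (G m) = {k. k < K \<and> nonzero_on (g k) (Ps ! m)}" if m: "m < M" for m
    unfolding nz_cols_def nonzero_on_def vec_restrict_def by (auto simp: G_def c_def vec_eq_iff)
  have G_indep: "\<forall>d. (\<forall>a<c m. (\<Sum>k<K. G m $$ (a,k) * d k) = 0) \<longrightarrow> (\<forall>k\<in>nz_cols (G m). d k = 0)"
    if m: "m < M" for m
  proof (intro allI impI ballI)
    fix d k assume 0: "\<forall>a<c m. (\<Sum>k<K. G m $$ (a,k) * d k) = 0" and k: "k \<in> nz_cols (G m)"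
    show "d k = 0"
    proof (rule modes_independent_onD)
      show "modes_independent_on K g (Ps ! m)" using indep m by (simp add: M_def)
      show "(\<Sum>k<K. g k $ x * d k) = 0" if x: "x \<in> Ps ! m" for x
      proof -
        obtain a where a: "a < c m" "x = pick (Ps ! m) a"
          using pickE[OF patch(2)[OF m] x] unfolding c_def by blast
        show ?thesis using 0 a by (simp add: G_def)
      qed
    qed (use k nz[OF m] in auto)
  qed
  have cols: "\<And>j k. j < K \<Longrightarrow> k < K \<Longrightarrow> ((U m)\<^sup>T * U m) $$ (j,k) = (if j = k \<and> k \<in> nz_cols (G m) then 1 else 0)"
    "\<And>i k. i < Km m \<Longrightarrow> k < K \<Longrightarrow> U m $$ (i,k) \<noteq> 0 \<Longrightarrow> k \<in> nz_cols (G m)"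
    "card (nz_cols (G m)) = Km m" if m: "m < M" for m
    using left_inverse_mult_nz_cols[OF G H(1-3)[OF m] gram[OF m] G_indep[OF m]] unfolding U_eq by blast+
  have LL: "LL \<gamma> h m n = U m * (U n)\<^sup>T" if mn: "m < M" "n < M" for m n
  proof -
    have "(U n)\<^sup>T = (G n)\<^sup>T * (left_pinv (H n))\<^sup>T" unfolding U_eq by (rule transpose_mult[OF H(2)[OF mn(2)] G])
    then show ?thesis unfolding LL_def H_def[symmetric] Ab[OF mn] U_eq
      using H(2)[OF mn(1)] H(2)[OF mn(2)] G[of m] G[of n]
      by (simp add: assoc_mult_mat[of _ "Km m" "c m" _ "c n" _ "Km n"] assoc_mult_mat[of _ "Km m" "c m" _ K _ "c n"]
        assoc_mult_mat[of _ "Km m" "c m" _ K _ "Km n"] assoc_mult_mat[of _ "c m" K _ "c n" _ "Km n"])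
  qed
  have min': "is_arg_min (\<lambda>V. \<Sum>n<M. off_diag_sq (Km m) (V\<^sup>T * ((U m * (U n)\<^sup>T) * (U m * (U n)\<^sup>T)\<^sup>T) * V))
      (real_orthogonal (Km m)) (D m)" if m: "m < M" for m
  proof -
    have "(\<lambda>V. \<Sum>n<M. off_diag_sq (Km m) (V\<^sup>T * (LL \<gamma> h m n * (LL \<gamma> h m n)\<^sup>T) * V)) =
      (\<lambda>V. \<Sum>n<M. off_diag_sq (Km m) (V\<^sup>T * ((U m * (U n)\<^sup>T) * (U m * (U n)\<^sup>T)\<^sup>T) * V))"
      by (intro ext sum.cong refl) (simp add: LL[OF m])
    with min[OF m] show ?thesis by simp
  qed
  have Lam_entry: "\<Lambda> $$ (sum Km {..<m} + i, sum Km {..<n} + j) = (U m * (U n)\<^sup>T) $$ (i,j)"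
    if "m < M" "n < M" "i < Km m" "j < Km n" for m n i j
    using submatrix_block_range[OF Lam that] Lam_block[OF that(1,2)] LL[OF that(1,2)] by simp
  have sub: "nz_cols (G m) \<subseteq> {..<K}" for m using G[of m] by (auto simp: nz_cols_def)
  obtain W where W: "W \<in> carrier_mat K K" "W * W\<^sup>T = 1\<^sub>m K"
    and cls: "\<And>j j' k m. j < K \<Longrightarrow> j' < K \<Longrightarrow> k < K \<Longrightarrow> W $$ (j,k) \<noteq> 0 \<Longrightarrow> W $$ (j',k) \<noteq> 0 \<Longrightarrow> m < M \<Longrightarrow>
      j \<in> nz_cols (G m) \<longleftrightarrow> j' \<in> nz_cols (G m)"
    and Q: "Q \<in> carrier_mat (sum Km {..<M}) (sum Km {..<M})" and L: "L \<in> carrier_mat (sum Km {..<M}) K"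
    and out: "\<And>m i k. m < M \<Longrightarrow> i < Km m \<Longrightarrow> k < K \<Longrightarrow>
      (diag_block_mat (map D [0..<M]) * (Q * L)) $$ (sum Km {..<m} + i, k) = (U m * W) $$ (i,k)"
    by (rule block_rotation[where M = M and U = U and r = Km and K = K and S = "\<lambda>m. nz_cols (G m)"
          and D = D and \<Lambda> = \<Lambda> and Q = Q and L = L])
      (erule U, erule (2) cols(1), erule (3) cols(2), erule cols(3), rule sub, erule min', rule Lam,
       erule (3) Lam_entry, rule chol, erule that, assumption, blast, assumption, assumption, blast)
  define Dx where "Dx = diag_block_mat (map D [0..<M])"
  define Hx where "Hx = diag_block_mat (map H [0..<M])"
  have D: "D m \<in> carrier_mat (Km m) (Km m)" if "m < M" for m
    using min[OF that] real_orthogonalD(1) by (auto simp: is_arg_min_def)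
  have Dx: "Dx \<in> carrier_mat (sum Km {..<M}) (sum Km {..<M})"
    unfolding Dx_def by (rule diag_block_mat_entry(1)) (rule D)
  have Hx: "Hx \<in> carrier_mat (sum c {..<M}) (sum Km {..<M})"
    unfolding Hx_def by (rule diag_block_mat_entry(1)) (rule H(1))
  have assoc: "Hx * Dx * Q * L = Hx * (Dx * (Q * L))"
    using Hx Dx Q L by (simp add: assoc_mult_mat[of _ "sum c {..<M}" "sum Km {..<M}" _ "sum Km {..<M}" _ "sum Km {..<M}"]
      assoc_mult_mat[of _ "sum c {..<M}" "sum Km {..<M}" _ "sum Km {..<M}" _ K]
      assoc_mult_mat[of _ "sum Km {..<M}" "sum Km {..<M}" _ "sum Km {..<M}" _ K])
  have on_patch: "g' k $ pick (Ps ! m) a = (\<Sum>j<K. g j $ pick (Ps ! m) a * W $$ (j,k))"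
    if m: "m < M" "a < c m" "k < K" for m a k
  proof -
    have pos: "sum c {..<m} + a < sum c {..<M}" by (rule block_pos_less[where s = c, OF m(1,2)])
    have "g' k $ pick (Ps ! m) a = vec_restrict (g' k) (Ps ! m) $ a"
      using m by (simp add: vec_restrict_def c_def)
    \<comment> \<open>The rows of the product list the patches one after the other, so position
      \<open>a\<close> of patch \<open>m\<close> is shifted by the total size of the earlier
      patches.\<close>
    also have "\<dots> = col (Hx * Dx * Q * L) k $ (sum c {..<m} + a)"
      unfolding g'_restrict[OF m(3,1)] Hx_def Dx_def H_def
      using m by (simp add: vec_restrict_def pick_block_range)
    also have "\<dots> = (Hx * (Dx * (Q * L))) $$ (sum c {..<m} + a, k)"
      unfolding assoc using pos m Hx Dx Q L by (intro index_col) auto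
    also have "\<dots> = (\<Sum>i<Km m. H m $$ (a,i) * (Dx * (Q * L)) $$ (sum Km {..<m} + i, k))"
      unfolding Hx_def using m Dx Q L H(1) by (intro diag_block_mat_mult_entry) auto
    also have "\<dots> = (\<Sum>i<Km m. H m $$ (a,i) * (U m * W) $$ (i, k))"
      using m out unfolding Dx_def by (intro sum.cong refl) simp
    also have "\<dots> = (H m * (U m * W)) $$ (a,k)"
      using m H(1)[OF m(1)] U[OF m(1)] W by (intro mult_entry[symmetric]) auto
    also have "H m * (U m * W) = G m * W"
      unfolding HU[OF m(1), symmetric] using H(1)[OF m(1)] U[OF m(1)] W by (intro assoc_mult_mat[symmetric]) auto
    also have "(G m * W) $$ (a,k) = (\<Sum>j<K. G m $$ (a,j) * W $$ (j,k))"
      using m G W by (intro mult_entry) auto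
    finally show ?thesis using m by (simp add: G_def)
  qed
  have entry: "g' k $ x = (\<Sum>j<K. g j $ x * W $$ (j,k))" if x: "x < N" "k < K" for x k
  proof -
    obtain m where m: "m < M" "x \<in> Ps ! m"
      using x part unfolding M_def partition_on_def by (metis UnionE in_set_conv_nth lessThan_iff)
    obtain a where a: "a < c m" "x = pick (Ps ! m) a"
      using pickE[OF patch(2)[OF m(1)] m(2)] unfolding c_def by blast
    show ?thesis using on_patch[OF m(1) a(1) x(2)] a by simp
  qed
  show thesis
  proof (rule that[OF W])
    show "modes_mat N K g' = modes_mat N K g * W"
    proof (rule eq_matI)
      fix x k assume "x < dim_row (modes_mat N K g * W)" "k < dim_col (modes_mat N K g * W)"
      then have xk: "x < N" "k < K" using W by (auto simp: modes_mat_def)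
      then have "(modes_mat N K g * W) $$ (x,k) = (\<Sum>j<K. modes_mat N K g $$ (x,j) * W $$ (j,k))"
        using W by (intro mult_entry) auto
      then show "modes_mat N K g' $$ (x,k) = (modes_mat N K g * W) $$ (x,k)"
        using entry[OF xk] xk by (simp add: modes_mat_def)
    qed (use W in \<open>auto simp: modes_mat_def\<close>)
    show "g' k \<in> carrier_vec N" if "k < K" for k using g'_car[OF that] A by simp
    fix j k assume jk: "j < K" "k < K" "W $$ (j,k) \<noteq> 0"
    have "nonzero_on (g' k) P \<longleftrightarrow> nonzero_on (g j) P" if P: "P \<in> set Ps" for P
    proof -
      obtain m where m: "m < M" "P = Ps ! m" using P unfolding M_def by (metis in_set_conv_nth)
      have fin: "finite P" and P_N: "P \<subseteq> {..<N}" using patch[OF m(1)] m by auto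
      show ?thesis
      proof
        assume "nonzero_on (g j) P"
        show "nonzero_on (g' k) P"
        proof (rule ccontr)
          assume "\<not> nonzero_on (g' k) P"
          \<comment> \<open>Column \<open>k\<close> of \<open>W\<close> would be a relation on
            \<open>P\<close>, and independence would force its entry at \<open>j\<close> to be
            zero.\<close>
          then have "(\<Sum>l<K. g l $ x * W $$ (l,k)) = 0" if "x \<in> P" for x
            using entry[of x k] that P_N jk nonzero_on_iff[OF fin] by auto
          from modes_independent_onD[of K g P "\<lambda>l. W $$ (l,k)", OF indep[OF P] this jk(1)]
          show False using \<open>nonzero_on (g j) P\<close> jk by simp
        qed
      next
        assume "nonzero_on (g' k) P"
        then obtain x where x: "x \<in> P" "g' k $ x \<noteq> 0" using nonzero_on_iff[OF fin] by blast
        then have "(\<Sum>l<K. g l $ x * W $$ (l,k)) \<noteq> 0" using entry[of x k] P_N jk by auto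
        then obtain l where "l < K" "g l $ x * W $$ (l,k) \<noteq> 0"
          by (metis (no_types, lifting) lessThan_iff sum.neutral)
        then have l: "l < K" "g l $ x \<noteq> 0" "W $$ (l,k) \<noteq> 0" by auto
        \<comment> \<open>The mode \<open>l\<close> contributes to \<open>g' k\<close> and is
          nonzero at \<open>x\<close>. It shares column \<open>k\<close> of \<open>W\<close> with
          \<open>j\<close>, so \<open>j\<close> belongs to the same patches.\<close>
        have "l \<in> nz_cols (G m)" unfolding nz[OF m(1)] using l x nonzero_on_iff[OF fin] m by blast
        then have "j \<in> nz_cols (G m)" using cls[OF l(1) jk(1,2) l(3) jk(3) m(1)] by blast
        then show "nonzero_on (g j) P" unfolding nz[OF m(1)] using m by simp
      qed
    qed
    then show "patch_support (set Ps) (g' k) = patch_support (set Ps) (g j)"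
      unfolding patch_support_def by auto
  qed
qed

subsection \<open>Comparing two partitions\<close>

text \<open>A nonzero term of the Leibniz expansion chooses a nonzero entry in every row; the
  inverse permutation reads the same choice column by column.\<close>

lemma rotation_transversal:
  fixes V :: "real mat"
  assumes V: "V \<in> carrier_mat K K" and "det V \<noteq> 0"
  obtains \<sigma> where "\<sigma> permutes {..<K}" "\<And>k. k < K \<Longrightarrow> V $$ (\<sigma> k, k) \<noteq> 0"
proof -
  have "(\<Sum>p \<in> {p. p permutes {0..<K}}. signof p * (\<Prod>i = 0..<K. V $$ (i, p i))) \<noteq> 0"
    using assms det_def'[OF V] by simp
  then obtain p where p: "p permutes {0..<K}" "signof p * (\<Prod>i = 0..<K. V $$ (i, p i)) \<noteq> 0"
    by (metis (no_types, lifting) mem_Collect_eq sum.neutral)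
  then have nz: "V $$ (i, p i) \<noteq> 0" if "i < K" for i using that by auto
  show thesis
  proof (rule that[of "inv_into UNIV p"])
    show "inv_into UNIV p permutes {..<K}" using permutes_inv[OF p(1)] by (simp add: lessThan_atLeast0)
    fix k assume "k < K"
    then have "inv_into UNIV p k < K" using permutes_in_image[OF permutes_inv[OF p(1)], of k] by simp
    then show "V $$ (inv_into UNIV p k, k) \<noteq> 0" using nz[of "inv_into UNIV p k"] permutes_inverses(1)[OF p(1)] by simp
  qed
qed

text \<open>Row \<open>i\<close> has norm \<open>1\<close> and at most one nonzero entry, which is
  therefore \<open>1\<close> or \<open>-1\<close>; this entry already exhausts the norm of column
  \<open>k\<close>.\<close>

lemma rotation_column_unit:
  fixes V :: "real mat"
  assumes V: "V \<in> carrier_mat K K" "V * V\<^sup>T = 1\<^sub>m K" "V\<^sup>T * V = 1\<^sub>m K" and ik: "i < K" "k < K"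
    and row: "\<And>l. l < K \<Longrightarrow> l \<noteq> k \<Longrightarrow> V $$ (i,l) = 0"
  shows "V $$ (i,k) = 1 \<or> V $$ (i,k) = -1" "\<And>j. j < K \<Longrightarrow> j \<noteq> i \<Longrightarrow> V $$ (j,k) = 0"
proof -
  have "1 = (V * V\<^sup>T) $$ (i,i)" using V(2) ik by simp
  also have "\<dots> = (\<Sum>l<K. V $$ (i,l) * V\<^sup>T $$ (l,i))" using V ik by (intro mult_entry) auto
  also have "\<dots> = (\<Sum>l<K. if l = k then V $$ (i,k) * V $$ (i,k) else 0)"
    using V(1) ik row by (intro sum.cong refl) auto
  finally have sq: "V $$ (i,k) * V $$ (i,k) = 1" using ik by simp
  then show "V $$ (i,k) = 1 \<or> V $$ (i,k) = -1" by (simp add: square_eq_1_iff)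
  fix j assume j: "j < K" "j \<noteq> i"
  have "1 = (V\<^sup>T * V) $$ (k,k)" using V(3) ik by simp
  also have "\<dots> = (\<Sum>l<K. V\<^sup>T $$ (k,l) * V $$ (l,k))" using V ik by (intro mult_entry) auto
  also have "\<dots> = (\<Sum>l<K. V $$ (l,k) * V $$ (l,k))" using V(1) ik by (intro sum.cong refl) auto
  also have "\<dots> = V $$ (i,k) * V $$ (i,k) + (\<Sum>l\<in>{..<K} - {i}. V $$ (l,k) * V $$ (l,k))"
    using ik by (intro sum.remove) auto
  finally have "(\<Sum>l\<in>{..<K} - {i}. V $$ (l,k) * V $$ (l,k)) = 0" using sq by simp
  then show "V $$ (j,k) = 0" using j by (subst (asm) sum_nonneg_eq_0_iff) auto
qed

theorem theorem3p2:
  fixes A :: "real mat" and N K :: nat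
    and \<P>\<^sub>c \<P>\<^sub>f :: "nat set set"
    and g\<^sub>c g\<^sub>f :: "nat \<Rightarrow> real vec"
  assumes "A \<in> carrier_mat N N"
    and "sym_psd A"
    and "K = vec_space.rank N A"
    and "partition_on {..<N} \<P>\<^sub>c"
    and "refines {..<N} \<P>\<^sub>f \<P>\<^sub>c"
    and "regular_sparse A \<P>\<^sub>f"
    and "ismd_modes A \<P>\<^sub>c g\<^sub>c"
    and "ismd_modes A \<P>\<^sub>f g\<^sub>f"
  shows "\<exists>\<sigma>. \<sigma> permutes {..<K} \<and>
    (\<forall>k<K.
       patch_support \<P>\<^sub>c (g\<^sub>f (\<sigma> k)) = patch_support \<P>\<^sub>c (g\<^sub>c k) \<and>
       patch_support \<P>\<^sub>f (g\<^sub>f (\<sigma> k)) \<subseteq> patch_support \<P>\<^sub>f (g\<^sub>c k) \<and>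
       ((\<forall>j<K. j \<noteq> k \<longrightarrow> \<not> unidentifiable \<P>\<^sub>c (g\<^sub>c k) (g\<^sub>c j)) \<longrightarrow>
          g\<^sub>f (\<sigma> k) = g\<^sub>c k \<or> g\<^sub>f (\<sigma> k) = - g\<^sub>c k))"
proof -
  have K: "K = mat_rank A" using assms(1,3) by auto
  have part_f: "partition_on {..<N} \<P>\<^sub>f" and ref: "\<And>F. F \<in> \<P>\<^sub>f \<Longrightarrow> \<exists>P\<in>\<P>\<^sub>c. F \<subseteq> P"
    using assms(5) unfolding refines_def by auto
  have part_c: "partition_on {..<N} \<P>\<^sub>c" by fact
  have sub_f: "F \<subseteq> {..<N}" if "F \<in> \<P>\<^sub>f" for F using part_f that unfolding partition_on_def by blast
  have sub_c: "P \<subseteq> {..<N}" if "P \<in> \<P>\<^sub>c" for P using part_c that unfolding partition_on_def by blast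
  have fin_f: "finite F" if "F \<in> \<P>\<^sub>f" for F by (rule finite_subset[OF sub_f[OF that]]) simp
  have fin_c: "finite P" if "P \<in> \<P>\<^sub>c" for P by (rule finite_subset[OF sub_c[OF that]]) simp
  \<comment> \<open>Refinement puts \<open>F\<close> into some coarse patch, which shares
    \<open>x\<close> with \<open>P\<close>; disjointness identifies the two.\<close>
  have fine_in_coarse: "\<exists>F\<in>\<P>\<^sub>f. x \<in> F \<and> F \<subseteq> P" if P: "P \<in> \<P>\<^sub>c" "x \<in> P" for P x
  proof -
    have "x \<in> \<Union>\<P>\<^sub>f" using sub_c[OF P(1)] P(2) part_f unfolding partition_on_def by blast
    then obtain F where F: "F \<in> \<P>\<^sub>f" "x \<in> F" by blast
    obtain P' where P': "P' \<in> \<P>\<^sub>c" "F \<subseteq> P'" using ref[OF F(1)] by blast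
    have "P' = P" using part_c P P' F(2) unfolding partition_on_def disjoint_def by blast
    then show ?thesis using F P' by blast
  qed
  obtain g where A_eq: "A = sum_outer N K (\<lambda>_. 1) g"
    and lin: "\<And>P. P \<in> \<P>\<^sub>f \<Longrightarrow> lin_indpt_family (card P) {k. k < K \<and> nonzero_on (g k) P} (\<lambda>k. vec_restrict (g k) P)"
    using assms(6) carrier_matD(1)[OF assms(1)] unfolding regular_sparse_def K[symmetric] by auto
  have indep_f: "modes_independent_on K g F" if "F \<in> \<P>\<^sub>f" for F
    by (rule lin_indpt_family_modes_independent_on[OF fin_f[OF that] lin[OF that]])
  have indep_c: "modes_independent_on K g P" if P: "P \<in> \<P>\<^sub>c" for P
    by (rule modes_independent_on_coarser[OF fin_c[OF P]]) (use fine_in_coarse[OF P] indep_f in blast)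
  obtain Pc where Pc: "set Pc = \<P>\<^sub>c" "ismd A Pc g\<^sub>c" using assms(7) unfolding ismd_modes_def by blast
  obtain Pf where Pf: "set Pf = \<P>\<^sub>f" "ismd A Pf g\<^sub>f" using assms(8) unfolding ismd_modes_def by blast
  obtain Wc where Wc: "Wc \<in> carrier_mat K K" "Wc * Wc\<^sup>T = 1\<^sub>m K" "modes_mat N K g\<^sub>c = modes_mat N K g * Wc"
    and supp_c: "\<And>j k. j < K \<Longrightarrow> k < K \<Longrightarrow> Wc $$ (j,k) \<noteq> 0 \<Longrightarrow> patch_support \<P>\<^sub>c (g\<^sub>c k) = patch_support \<P>\<^sub>c (g j)"
    and car_c: "\<And>k. k < K \<Longrightarrow> g\<^sub>c k \<in> carrier_vec N"
    using ismd_rotation[OF assms(1) _ K A_eq _ Pc(2), unfolded Pc(1), OF part_c indep_c] by metis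
  obtain Wf where Wf: "Wf \<in> carrier_mat K K" "Wf * Wf\<^sup>T = 1\<^sub>m K" "modes_mat N K g\<^sub>f = modes_mat N K g * Wf"
    and supp_f: "\<And>j k. j < K \<Longrightarrow> k < K \<Longrightarrow> Wf $$ (j,k) \<noteq> 0 \<Longrightarrow> patch_support \<P>\<^sub>f (g\<^sub>f k) = patch_support \<P>\<^sub>f (g j)"
    and car_f: "\<And>k. k < K \<Longrightarrow> g\<^sub>f k \<in> carrier_vec N"
    using ismd_rotation[OF assms(1) _ K A_eq _ Pf(2), unfolded Pf(1), OF part_f indep_f] by metis
  have Wct: "Wc\<^sup>T * Wc = 1\<^sub>m K" by (rule mat_mult_left_right_inverse[OF Wc(1) _ Wc(2)]) (use Wc in simp)
  have Wft: "Wf\<^sup>T * Wf = 1\<^sub>m K" by (rule mat_mult_left_right_inverse[OF Wf(1) _ Wf(2)]) (use Wf in simp)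
  \<comment> \<open>A vector is nonzero on a coarse patch exactly if it is nonzero on some fine
    patch inside it, so the fine support determines the coarse one.\<close>
  have coarse_supp: "patch_support \<P>\<^sub>c u = patch_support \<P>\<^sub>c v"
    if uv: "patch_support \<P>\<^sub>f u = patch_support \<P>\<^sub>f v" for u v
  proof -
    have "nonzero_on w P \<longleftrightarrow> (\<exists>F\<in>patch_support \<P>\<^sub>f w. F \<subseteq> P)" if P: "P \<in> \<P>\<^sub>c" for P w
    proof
      assume "nonzero_on w P"
      then obtain x where x: "x \<in> P" "w $ x \<noteq> 0" using nonzero_on_iff[OF fin_c[OF P]] by blast
      then obtain F where "F \<in> \<P>\<^sub>f" "x \<in> F" "F \<subseteq> P" using fine_in_coarse[OF P] by blast
      then show "\<exists>F\<in>patch_support \<P>\<^sub>f w. F \<subseteq> P"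
        using x nonzero_on_iff[OF fin_f] unfolding patch_support_def by blast
    next
      assume "\<exists>F\<in>patch_support \<P>\<^sub>f w. F \<subseteq> P"
      then show "nonzero_on w P"
        using nonzero_on_iff[OF fin_f] nonzero_on_iff[OF fin_c[OF P]] unfolding patch_support_def by blast
    qed
    then show ?thesis using uv unfolding patch_support_def[of \<P>\<^sub>c] by auto
  qed
  \<comment> \<open>As both outputs are orthogonal transformations of the same \<open>g\<close>,
    this \<open>V\<close> carries the fine output to the coarse one.\<close>
  define V where "V = Wf\<^sup>T * Wc"
  have V: "V \<in> carrier_mat K K" unfolding V_def using Wf Wc by simp
  have Vt: "V\<^sup>T = Wc\<^sup>T * Wf" unfolding V_def using Wf(1) Wc(1) by (subst transpose_mult[of _ K K]) auto
  have "V * V\<^sup>T = Wf\<^sup>T * ((Wc * Wc\<^sup>T) * Wf)" unfolding Vt unfolding V_def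
    using Wf(1) Wc(1) by (simp add: assoc_mult_mat[of _ K K _ K _ K])
  then have VVt: "V * V\<^sup>T = 1\<^sub>m K" using Wc(2) Wft Wf(1) by simp
  have VtV: "V\<^sup>T * V = 1\<^sub>m K" by (rule mat_mult_left_right_inverse[OF V _ VVt]) (use V in simp)
  have "modes_mat N K g\<^sub>f * V = modes_mat N K g * ((Wf * Wf\<^sup>T) * Wc)" unfolding Wf(3) V_def
    using Wf(1) Wc(1) by (simp add: assoc_mult_mat[of _ N K _ K _ K] assoc_mult_mat[of _ K K _ K _ K])
  then have gV: "modes_mat N K g\<^sub>c = modes_mat N K g\<^sub>f * V" using Wc Wf(2) by simp
  have "det V * det (V\<^sup>T) = 1" using det_mult[OF V, of "V\<^sup>T"] VVt V by simp
  then have "det V \<noteq> 0" by auto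
  then obtain \<sigma> where \<sigma>: "\<sigma> permutes {..<K}" "\<And>k. k < K \<Longrightarrow> V $$ (\<sigma> k, k) \<noteq> 0"
    using rotation_transversal[OF V] by blast
  have \<sigma>K: "\<sigma> k < K" if "k < K" for k using permutes_in_image[OF \<sigma>(1), of k] that by simp
  \<comment> \<open>A nonzero entry of \<open>V\<close> yields a sparse mode that enters both
    \<open>g\<^sub>f j\<close> and \<open>g\<^sub>c k\<close>; their supports are compared through
    it.\<close>
  have common: "\<exists>l<K. Wf $$ (l,j) \<noteq> 0 \<and> Wc $$ (l,k) \<noteq> 0" if jk: "j < K" "k < K" "V $$ (j,k) \<noteq> 0" for j k
  proof -
    have "V $$ (j,k) = (\<Sum>l<K. Wf\<^sup>T $$ (j,l) * Wc $$ (l,k))"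
      unfolding V_def using Wf(1) Wc(1) jk by (intro mult_entry) auto
    with jk(3) obtain l where "l < K" "Wf\<^sup>T $$ (j,l) * Wc $$ (l,k) \<noteq> 0"
      by (metis (no_types, lifting) lessThan_iff sum.neutral)
    then show ?thesis using Wf(1) jk by auto
  qed
  have supp_c_eq: "patch_support \<P>\<^sub>c (g\<^sub>f j) = patch_support \<P>\<^sub>c (g\<^sub>c k)"
    if jk: "j < K" "k < K" "V $$ (j,k) \<noteq> 0" for j k
  proof -
    obtain l where l: "l < K" "Wf $$ (l,j) \<noteq> 0" "Wc $$ (l,k) \<noteq> 0" using common[OF jk] by blast
    show ?thesis using coarse_supp[OF supp_f[OF l(1) jk(1) l(2)]] supp_c[OF l(1) jk(2) l(3)] by simp
  qed
  \<comment> \<open>An inclusion rather than an equality, since \<open>Wc\<close> may mix sparse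
    modes with equal coarse but different fine supports. Independence on the fine patch
    \<open>F\<close> keeps the contribution of \<open>g l\<close> to \<open>g\<^sub>c k\<close> from
    being cancelled there.\<close>
  have supp_f_sub: "patch_support \<P>\<^sub>f (g\<^sub>f j) \<subseteq> patch_support \<P>\<^sub>f (g\<^sub>c k)"
    if jk: "j < K" "k < K" "V $$ (j,k) \<noteq> 0" for j k
  proof
    obtain l where l: "l < K" "Wf $$ (l,j) \<noteq> 0" "Wc $$ (l,k) \<noteq> 0" using common[OF jk] by blast
    fix F assume "F \<in> patch_support \<P>\<^sub>f (g\<^sub>f j)"
    then have F: "F \<in> \<P>\<^sub>f" "nonzero_on (g l) F"
      unfolding supp_f[OF l(1) jk(1) l(2)] by (auto simp: patch_support_def)
    have "nonzero_on (g\<^sub>c k) F"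
    proof (rule ccontr)
      assume "\<not> nonzero_on (g\<^sub>c k) F"
      then have 0: "g\<^sub>c k $ x = 0" if "x \<in> F" for x using that nonzero_on_iff[OF fin_f[OF F(1)]] by blast
      have "(\<Sum>j<K. g j $ x * Wc $$ (j,k)) = 0" if "x \<in> F" for x
        using modes_mat_mult_entry[OF Wc(3,1) _ jk(2), of x] 0[OF that] sub_f[OF F(1)] that by auto
      from modes_independent_onD[of K g F "\<lambda>j. Wc $$ (j,k)", OF indep_f[OF F(1)] this l(1) F(2)] l(3)
      show False by simp
    qed
    then show "F \<in> patch_support \<P>\<^sub>f (g\<^sub>c k)" using F by (simp add: patch_support_def)
  qed
  have ident: "g\<^sub>f (\<sigma> k) = g\<^sub>c k \<or> g\<^sub>f (\<sigma> k) = - g\<^sub>c k"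
    if k: "k < K" and id: "\<forall>j<K. j \<noteq> k \<longrightarrow> \<not> unidentifiable \<P>\<^sub>c (g\<^sub>c k) (g\<^sub>c j)" for k
  proof -
    \<comment> \<open>A second nonzero entry in this row would give \<open>g\<^sub>c k\<close> and
      \<open>g\<^sub>c l\<close> the coarse support of \<open>g\<^sub>f (\<sigma> k)\<close>,
      against identifiability.\<close>
    have row: "V $$ (\<sigma> k, l) = 0" if l: "l < K" "l \<noteq> k" for l
    proof (rule ccontr)
      assume "V $$ (\<sigma> k, l) \<noteq> 0"
      then have "patch_support \<P>\<^sub>c (g\<^sub>c k) = patch_support \<P>\<^sub>c (g\<^sub>c l)"
        using supp_c_eq[OF \<sigma>K[OF k] l(1)] supp_c_eq[OF \<sigma>K[OF k] k \<sigma>(2)[OF k]] by simp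
      then show False using id l unfolding unidentifiable_def by blast
    qed
    note unit = rotation_column_unit[OF V VVt VtV \<sigma>K[OF k] k row]
    \<comment> \<open>Column \<open>k\<close> of \<open>V\<close> vanishes outside row
      \<open>\<sigma> k\<close>, so a single fine mode is left in the combination.\<close>
    have val: "g\<^sub>c k $ x = g\<^sub>f (\<sigma> k) $ x * V $$ (\<sigma> k, k)" if x: "x < N" for x
    proof -
      have "g\<^sub>c k $ x = (\<Sum>j<K. g\<^sub>f j $ x * V $$ (j,k))" by (rule modes_mat_mult_entry[OF gV V x k])
      also have "\<dots> = (\<Sum>j<K. if j = \<sigma> k then g\<^sub>f (\<sigma> k) $ x * V $$ (\<sigma> k, k) else 0)"
        using unit(2) by (intro sum.cong refl) auto
      finally show ?thesis using \<sigma>K[OF k] by simp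
    qed
    have "g\<^sub>c k = g\<^sub>f (\<sigma> k)" if "V $$ (\<sigma> k, k) = 1"
      using val that car_c[OF k] car_f[OF \<sigma>K[OF k]] by (intro eq_vecI) auto
    moreover have "g\<^sub>f (\<sigma> k) = - g\<^sub>c k" if "V $$ (\<sigma> k, k) = -1"
      using val that car_c[OF k] car_f[OF \<sigma>K[OF k]] by (intro eq_vecI) auto
    ultimately show ?thesis using unit(1) by auto
  qed
  show ?thesis
  proof (intro exI[of _ \<sigma>] conjI allI impI)
    fix k assume k: "k < K"
    show "patch_support \<P>\<^sub>c (g\<^sub>f (\<sigma> k)) = patch_support \<P>\<^sub>c (g\<^sub>c k)"
      by (rule supp_c_eq[OF \<sigma>K[OF k] k \<sigma>(2)[OF k]])
    show "patch_support \<P>\<^sub>f (g\<^sub>f (\<sigma> k)) \<subseteq> patch_support \<P>\<^sub>f (g\<^sub>c k)"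
      by (rule supp_f_sub[OF \<sigma>K[OF k] k \<sigma>(2)[OF k]])
  qed (use \<sigma>(1) ident in blast)+
qed

end
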